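(* Let $M$ be a compact path-connected smooth manifold without boundary and let $\Phi\colon M\to\mathbb{R}$ be a Morse-Bott function. Let $c_1<\dots<c_p$ be the critical values of $\Phi$, let $\operatorname{Crit}\Phi$ be the set of critical points of $\Phi$, and for each $i=1,\dots,p$ let $\Sigma_i=\Phi^{-1}(c_i)\cap\operatorname{Crit}\Phi$ be the set of critical points in the level $\Phi=c_i$. Let $Y$ be a path-connected topological space. If $f,g\colon M\to Y$ are two continuous maps, then $$\mathrm{D}(f,g)+1\leq\sum_{i=1}^p\bigl(\mathrm{D}_M(\Sigma_i;f,g)+1\bigr).$$
   Context: A smooth function $\Phi\colon M\to\mathbb{R}$ on a compact differentiable manifold is a Morse-Bott function if its critical set $\operatorname{Crit}\Phi$ is a disjoint union of connected submanifolds $\Sigma$ and, for each critical point $p\in\Sigma$, the Hessian of $\Phi$ at $p$ is non-degenerate in the directions transverse to $\Sigma$. Homotopic distance: for continuous maps $f,g\colon X\to Y$, $\mathrm{D}(f,g)$ is the least integer $n\geq 0$ such that there is an open covering $U_0\cup\dots\cup U_n=X$ for which the restrictions $f_{|U_j}$ and $g_{|U_j}$ are homotopic as maps $U_j\to Y$, for all $j=0,\dots,n$; if there is no such covering, $\mathrm{D}(f,g)=\infty$. Subspace distance: for a subspace $A\subset X$, $\mathrm{D}_X(A;f,g):=\mathrm{D}(f_{|A},g_{|A})$, the homotopic distance of the restrictions $f_{|A},g_{|A}\colon A\to Y$ (so the covering sets are open in $A$). The subspace $A$ need not be connected. *)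

theory Defs
  imports "HOL-Analysis.Analysis"
begin

section \<open>Smooth manifolds\<close>

text \<open>
  Charts take values in a type of class \<open>{real_inner,heine_borel}\<close>. By Riesz' theorem these are
  exactly the finite-dimensional real inner product spaces, so that, in contrast to class
  \<open>euclidean_space\<close>, dimension 0 is included. Only the vector space structure and the topology
  enter the definitions, not the choice of inner product.
\<close>

text \<open>Functions of class $C^k$ and $C^\infty$; to be used for open sets \<open>U\<close> only.\<close>

primrec Ck_on :: "nat \<Rightarrow> 'e::real_normed_vector set \<Rightarrow> ('e \<Rightarrow> 'f::real_normed_vector) \<Rightarrow> bool" where
  "Ck_on 0 U f \<longleftrightarrow> continuous_on U f"
| "Ck_on (Suc k) U f \<longleftrightarrow>
     (\<forall>x\<in>U. f differentiable (at x)) \<and> (\<forall>v. Ck_on k U (\<lambda>x. frechet_derivative f (at x) v))"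

definition smooth_on :: "'e::real_normed_vector set \<Rightarrow> ('e \<Rightarrow> 'f::real_normed_vector) \<Rightarrow> bool" where
  "smooth_on U f \<longleftrightarrow> (\<forall>k. Ck_on k U f)"

text \<open>A chart is a pair \<open>(U, \<phi>)\<close>; the values of \<open>\<phi>\<close> outside of \<open>U\<close> are irrelevant, and
  \<open>inv_into U \<phi>\<close> is the inverse of the chart, meaningful on \<open>\<phi> ` U\<close>.\<close>

definition is_chart :: "'m topology \<Rightarrow> 'm set \<times> ('m \<Rightarrow> 'e::{real_inner,heine_borel}) \<Rightarrow> bool" where
  "is_chart M = (\<lambda>(U, \<phi>). openin M U \<and> open (\<phi> ` U) \<and>
     homeomorphic_map (subtopology M U) (top_of_set (\<phi> ` U)) \<phi>)"

definition compatible_charts ::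
  "'m set \<times> ('m \<Rightarrow> 'e::{real_inner,heine_borel}) \<Rightarrow> 'm set \<times> ('m \<Rightarrow> 'e) \<Rightarrow> bool" where
  "compatible_charts = (\<lambda>(U, \<phi>) (V, \<psi>).
     smooth_on (\<phi> ` (U \<inter> V)) (\<psi> \<circ> inv_into U \<phi>) \<and>
     smooth_on (\<psi> ` (U \<inter> V)) (\<phi> \<circ> inv_into V \<psi>))"

definition smooth_atlas :: "'m topology \<Rightarrow> ('m set \<times> ('m \<Rightarrow> 'e::{real_inner,heine_borel})) set \<Rightarrow> bool" where
  "smooth_atlas M A \<longleftrightarrow>
     (\<forall>a\<in>A. is_chart M a) \<and> \<Union>(fst ` A) = topspace M \<and> (\<forall>a\<in>A. \<forall>b\<in>A. compatible_charts a b)"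

text \<open>A smooth manifold (without boundary) of dimension \<open>dim (UNIV :: 'e set)\<close>; the smooth
  structure \<open>A\<close> is a maximal smooth atlas.\<close>

definition smooth_manifold :: "'m topology \<Rightarrow> ('m set \<times> ('m \<Rightarrow> 'e::{real_inner,heine_borel})) set \<Rightarrow> bool" where
  "smooth_manifold M A \<longleftrightarrow>
     Hausdorff_space M \<and> second_countable M \<and> smooth_atlas M A \<and>
     (\<forall>a. is_chart M a \<and> (\<forall>b\<in>A. compatible_charts a b) \<longrightarrow> a \<in> A)"

definition smooth_function ::
  "('m set \<times> ('m \<Rightarrow> 'e::{real_inner,heine_borel})) set \<Rightarrow> ('m \<Rightarrow> real) \<Rightarrow> bool" where
  "smooth_function A \<Phi> \<longleftrightarrow> (\<forall>(U, \<phi>)\<in>A. smooth_on (\<phi> ` U) (\<Phi> \<circ> inv_into U \<phi>))"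

text \<open>\<open>slice_chart A S U \<phi> L\<close>: in the chart \<open>(U, \<phi>)\<close> of \<open>A\<close> the set \<open>S\<close> corresponds to the linear
  subspace \<open>L\<close>. For \<open>p \<in> U \<inter> S\<close>, the chart then identifies the tangent space of \<open>S\<close> at \<open>p\<close>
  with \<open>L\<close>.\<close>

definition slice_chart :: "('m set \<times> ('m \<Rightarrow> 'e::{real_inner,heine_borel})) set \<Rightarrow> 'm set \<Rightarrow>
    'm set \<Rightarrow> ('m \<Rightarrow> 'e) \<Rightarrow> 'e set \<Rightarrow> bool" where
  "slice_chart A S U \<phi> L \<longleftrightarrow> (U, \<phi>) \<in> A \<and> subspace L \<and> \<phi> ` (U \<inter> S) = \<phi> ` U \<inter> L"

text \<open>Embedded submanifolds of dimension \<open>d\<close>.\<close>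

definition smooth_submanifold :: "'m topology \<Rightarrow> ('m set \<times> ('m \<Rightarrow> 'e::{real_inner,heine_borel})) set \<Rightarrow>
    nat \<Rightarrow> 'm set \<Rightarrow> bool" where
  "smooth_submanifold M A d S \<longleftrightarrow>
     S \<subseteq> topspace M \<and> (\<forall>p\<in>S. \<exists>U \<phi> L. p \<in> U \<and> slice_chart A S U \<phi> L \<and> dim L = d)"


section \<open>Morse-Bott functions\<close>

definition critical_points :: "'m topology \<Rightarrow> ('m set \<times> ('m \<Rightarrow> 'e::{real_inner,heine_borel})) set \<Rightarrow>
    ('m \<Rightarrow> real) \<Rightarrow> 'm set" where
  "critical_points M A \<Phi> = {p \<in> topspace M.
     \<forall>(U, \<phi>)\<in>A. p \<in> U \<longrightarrow> frechet_derivative (\<Phi> \<circ> inv_into U \<phi>) (at (\<phi> p)) = (\<lambda>v. 0)}"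

definition critical_values :: "'m topology \<Rightarrow> ('m set \<times> ('m \<Rightarrow> 'e::{real_inner,heine_borel})) set \<Rightarrow>
    ('m \<Rightarrow> real) \<Rightarrow> real set" where
  "critical_values M A \<Phi> = \<Phi> ` critical_points M A \<Phi>"

text \<open>The Hessian at \<open>p\<close> in the chart \<open>(U, \<phi>)\<close>; at a critical point it is a well-defined
  bilinear form on the tangent space, independent of the chart.\<close>

definition hessian :: "('m \<Rightarrow> real) \<Rightarrow> 'm set \<Rightarrow> ('m \<Rightarrow> 'e::{real_inner,heine_borel}) \<Rightarrow> 'm \<Rightarrow>
    'e \<Rightarrow> 'e \<Rightarrow> real" where
  "hessian \<Phi> U \<phi> p v w =
     frechet_derivative (\<lambda>x. frechet_derivative (\<Phi> \<circ> inv_into U \<phi>) (at x) v) (at (\<phi> p)) w"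

text \<open>For a submanifold \<open>S\<close> of critical points the Hessian vanishes on $T_pS$ in either argument
  and hence induces a bilinear form on the normal space $T_pM / T_pS$. The following says
  that this form is non-degenerate: no $v \notin T_pS$ is Hessian-orthogonal to everything.\<close>

definition transversally_nondegenerate :: "('m set \<times> ('m \<Rightarrow> 'e::{real_inner,heine_borel})) set \<Rightarrow>
    ('m \<Rightarrow> real) \<Rightarrow> 'm set \<Rightarrow> 'm \<Rightarrow> bool" where
  "transversally_nondegenerate A \<Phi> S p \<longleftrightarrow>
     (\<forall>U \<phi> L. p \<in> U \<and> slice_chart A S U \<phi> L \<longrightarrow>
        (\<forall>v. (\<forall>w. hessian \<Phi> U \<phi> p v w = 0) \<longrightarrow> v \<in> L))"

definition morse_bott :: "'m topology \<Rightarrow> ('m set \<times> ('m \<Rightarrow> 'e::{real_inner,heine_borel})) set \<Rightarrow>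
    ('m \<Rightarrow> real) \<Rightarrow> bool" where
  "morse_bott M A \<Phi> \<longleftrightarrow> smooth_function A \<Phi> \<and>
     (\<exists>\<S>. pairwise disjnt \<S> \<and> \<Union>\<S> = critical_points M A \<Phi> \<and>
        (\<forall>S\<in>\<S>. connectedin M S \<and> (\<exists>d. smooth_submanifold M A d S) \<and>
           (\<forall>p\<in>S. transversally_nondegenerate A \<Phi> S p)))"


section \<open>Homotopic distance\<close>

text \<open>Note that \<open>Inf {} = \<infinity>\<close> in \<open>enat\<close>.\<close>

definition homotopic_distance :: "'a topology \<Rightarrow> 'b topology \<Rightarrow> ('a \<Rightarrow> 'b) \<Rightarrow> ('a \<Rightarrow> 'b) \<Rightarrow> enat" where
  "homotopic_distance X Y f g = Inf {enat n | n. \<exists>U :: nat \<Rightarrow> 'a set.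
     (\<forall>j\<le>n. openin X (U j)) \<and> (\<Union>j\<le>n. U j) = topspace X \<and>
     (\<forall>j\<le>n. homotopic_with (\<lambda>_. True) (subtopology X (U j)) Y f g)}"

definition subspace_distance ::
  "'a topology \<Rightarrow> 'a set \<Rightarrow> 'b topology \<Rightarrow> ('a \<Rightarrow> 'b) \<Rightarrow> ('a \<Rightarrow> 'b) \<Rightarrow> enat" where
  "subspace_distance X A Y f g = homotopic_distance (subtopology X A) Y f g"

end

theory Submission
  imports Defs
begin

text \<open>
  Instead of the gradient flow we use finite compositions of ``pushes'': maps \<open>h\<close> homotopic to the
  identity of \<open>M\<close> that are supported in a chart ball. Near a non-critical point a push along a
  constant vector strictly decreases \<open>\<Phi>\<close>. Near a critical point, transverse non-degeneracy makes
  \<open>Crit \<Phi>\<close> locally equal to a slice, and a push along the orthogonal projection onto the slice sends a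
  neighbourhood of the point into \<open>\<Sigma>\<^sub>i\<close> while fixing \<open>\<Sigma>\<^sub>i\<close>. Pulling back homotopies along pushes
  shows that \<open>\<Sigma>\<^sub>i\<close> has a neighbourhood covered by as many good open sets as \<open>\<Sigma>\<^sub>i\<close> itself, and that
  everything else near the level \<open>c\<^sub>i\<close> can be pushed below that level. Hence the number of good open
  sets needed to cover a sublevel set grows by at most \<open>D\<^sub>M(\<Sigma>\<^sub>i; f, g) + 1\<close> at \<open>c\<^sub>i\<close>, and not at all
  at regular levels.
\<close>

section \<open>Critical sets in a finite-dimensional space\<close>

text \<open>Only the homotopy class of a push matters: if \<open>h\<close> is homotopic to the
  identity of M, then over the preimage of a good set f is homotopic to f after h, this to g after
  h, and this to g. The homotopy from the identity to \<open>h\<close> may leave sublevel sets and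
  \<open>h\<close> may fail to be injective, so local pushes can be composed freely. The obstacle is
  uniformity. Descending pushes are supported where some directional derivative is negative, so they
  fix all critical points and their drop tends to zero near \<Sigma>. A definite drop exists only on
  a compact set away from \<Sigma>. Hence a neighbourhood N of \<Sigma> is cut out and paid for by
  the sets that cover \<Sigma>. Those are open in \<Sigma> only; their preimages under a push that
  sends N into \<Sigma> are open in M. The admissible step across a level depends on that level
  without an a priori lower bound, which is why the levels are swept by a supremum argument on the
  real line.\<close>

text \<open>Distinct orthonormal vectors are at distance sqrt 2, whereas an infinite subset of the
  compact unit ball has a limit point and so contains two members at distance less than 1.\<close>

lemma orthonormal_imp_finite:
  fixes B :: "'e::{real_inner,heine_borel} set"
  assumes norm1: "\<And>b. b \<in> B \<Longrightarrow> norm b = 1"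
    and orth: "\<And>a b. a \<in> B \<Longrightarrow> b \<in> B \<Longrightarrow> a \<noteq> b \<Longrightarrow> a \<bullet> b = 0"
  shows "finite B"
proof (rule ccontr)
  assume inf: "infinite B"
  have "B \<subseteq> cball 0 1"
    using norm1 by auto
  then obtain x where x: "x islimpt B"
    using inf compact_cball compact_eq_Bolzano_Weierstrass by blast
  obtain a where a: "a \<in> B" "a \<noteq> x" "dist a x < 1/2"
    using x unfolding islimpt_approachable by (metis half_gt_zero_iff zero_less_one)
  obtain b where b: "b \<in> B" "b \<noteq> x" "dist b x < dist a x"
    using x a unfolding islimpt_approachable by (metis zero_less_dist_iff)
  have "a \<bullet> b = 0" "a \<bullet> a = 1" "b \<bullet> b = 1"
    using orth[of a b] norm1 a b by (auto simp: dot_square_norm)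
  then have "(norm (a - b))\<^sup>2 = 2"
    by (simp add: power2_norm_eq_inner inner_diff inner_commute)
  moreover have "norm (a - b) < 1"
    using a b dist_triangle2[of a b x] by (simp add: dist_norm)
  then have "(norm (a - b))\<^sup>2 < 1"
    by (simp add: abs_square_less_1)
  ultimately show False
    by simp
qed

text \<open>The model space carries no distinguished basis, so a maximal orthonormal subset of
  \<open>L\<close> is taken by Zorn's lemma. Were some \<open>x\<close> in \<open>L\<close> not
  recovered by its expansion, the normalised remainder would enlarge that subset.\<close>

lemma orthonormal_basis_exists:
  fixes L :: "'e::{real_inner,heine_borel} set"
  assumes L: "subspace L"
  shows "\<exists>B\<subseteq>L. finite B \<and> (\<forall>b\<in>B. norm b = 1) \<and> (\<forall>a\<in>B. \<forall>b\<in>B. a \<noteq> b \<longrightarrow> a \<bullet> b = 0) \<and>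
    (\<forall>x\<in>L. (\<Sum>b\<in>B. (x \<bullet> b) *\<^sub>R b) = x)"
proof -
  define \<A> where "\<A> = {B. B \<subseteq> L \<and> (\<forall>b\<in>B. norm b = 1) \<and> (\<forall>a\<in>B. \<forall>b\<in>B. a \<noteq> b \<longrightarrow> a \<bullet> b = 0)}"
  have "\<exists>B\<in>\<A>. \<forall>X\<in>\<A>. B \<subseteq> X \<longrightarrow> X = B"
  proof (rule subset_Zorn')
    fix C assume C: "subset.chain \<A> C"
    then have sub: "C \<subseteq> \<A>" and comp: "\<And>X Y. X \<in> C \<Longrightarrow> Y \<in> C \<Longrightarrow> X \<subseteq> Y \<or> Y \<subseteq> X"
      unfolding subset.chain_def by blast+
    have "a \<bullet> b = 0" if ab: "a \<in> \<Union>C" "b \<in> \<Union>C" "a \<noteq> b" for a b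
    proof -
      obtain X Y where "X \<in> C" "Y \<in> C" "a \<in> X" "b \<in> Y"
        using ab by blast
      then obtain Z where "Z \<in> C" "a \<in> Z" "b \<in> Z"
        using comp by blast
      then show ?thesis
        using sub ab(3) by (auto simp: \<A>_def)
    qed
    moreover have "X \<subseteq> L \<and> (\<forall>b\<in>X. norm b = 1)" if "X \<in> C" for X
      using sub that by (auto simp: \<A>_def)
    ultimately show "\<Union>C \<in> \<A>"
      unfolding \<A>_def mem_Collect_eq by (intro conjI ballI impI Union_least) blast+
  qed
  then obtain B where B: "B \<in> \<A>" and max: "\<And>X. X \<in> \<A> \<Longrightarrow> B \<subseteq> X \<Longrightarrow> X = B"
    by blast
  have BL: "B \<subseteq> L" and n1: "\<And>b. b \<in> B \<Longrightarrow> norm b = 1"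
    and o: "\<And>a b. a \<in> B \<Longrightarrow> b \<in> B \<Longrightarrow> a \<noteq> b \<Longrightarrow> a \<bullet> b = 0"
    using B by (auto simp: \<A>_def)
  have fin: "finite B"
    using n1 o by (rule orthonormal_imp_finite)
  have "(\<Sum>b\<in>B. (x \<bullet> b) *\<^sub>R b) = x" if x: "x \<in> L" for x
  proof (rule ccontr)
    define y where "y = x - (\<Sum>b\<in>B. (x \<bullet> b) *\<^sub>R b)"
    define z where "z = y /\<^sub>R norm y"
    assume "\<not> ?thesis"
    then have y0: "y \<noteq> 0"
      by (simp add: y_def)
    have yL: "y \<in> L"
      unfolding y_def by (intro subspace_diff subspace_sum subspace_scale L x) (use BL in auto)
    have yb: "y \<bullet> a = 0" if a: "a \<in> B" for a
    proof -
      have "(\<Sum>b\<in>B. (x \<bullet> b) *\<^sub>R b) \<bullet> a = (\<Sum>b\<in>B. if b = a then x \<bullet> a else 0)"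
        unfolding inner_sum_left using o a n1[OF a]
        by (intro sum.cong) (auto simp: dot_square_norm)
      also have "\<dots> = x \<bullet> a"
        using fin a by simp
      finally show ?thesis
        by (simp add: y_def inner_diff_left)
    qed
    have z: "z \<in> L" "norm z = 1" "\<And>a. a \<in> B \<Longrightarrow> z \<bullet> a = 0" "\<And>a. a \<in> B \<Longrightarrow> a \<bullet> z = 0"
      using yL y0 yb L by (auto simp: z_def subspace_scale inner_commute)
    have "insert z B \<in> \<A>"
      using z BL n1 o by (simp add: \<A>_def)
    then have "z \<in> B"
      using max by blast
    then show False
      using z by force
  qed
  then show ?thesis
    using BL fin n1 o by (intro exI[of _ B]) simp
qed

text \<open>The norm bound follows from orthogonality of \<open>x - P x\<close> and
  \<open>P x\<close> together with Cauchy-Schwarz. It serves to show that \<open>P\<close> preserves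
  every ball centred at a point of \<open>L\<close>.\<close>

lemma subspace_projection_exists:
  fixes L :: "'e::{real_inner,heine_borel} set"
  assumes L: "subspace L"
  obtains P where "bounded_linear P" "\<And>x. P x \<in> L" "\<And>x. x \<in> L \<Longrightarrow> P x = x" "\<And>x. norm (P x) \<le> norm x"
proof -
  obtain B where B: "B \<subseteq> L" "finite B" "\<forall>b\<in>B. norm b = 1"
    and o: "\<forall>a\<in>B. \<forall>b\<in>B. a \<noteq> b \<longrightarrow> a \<bullet> b = 0"
    and id: "\<forall>x\<in>L. (\<Sum>b\<in>B. (x \<bullet> b) *\<^sub>R b) = x"
    using orthonormal_basis_exists[OF L] by blast
  define P where "P x = (\<Sum>b\<in>B. (x \<bullet> b) *\<^sub>R b)" for x :: 'e
  have PL: "P x \<in> L" for x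
    unfolding P_def by (intro subspace_sum subspace_scale L) (use B in auto)
  have Pa: "P x \<bullet> a = x \<bullet> a" if a: "a \<in> B" for x a
  proof -
    have "P x \<bullet> a = (\<Sum>b\<in>B. if b = a then x \<bullet> a else 0)"
      unfolding inner_sum_left P_def using o a B(3)
      by (intro sum.cong) (auto simp: dot_square_norm)
    then show ?thesis
      using B a by simp
  qed
  have "(x - P x) \<bullet> P x = 0" for x
    by (subst (2) P_def) (simp add: inner_sum_right inner_diff_left Pa)
  then have "P x \<bullet> P x = x \<bullet> P x" for x
    by (simp add: inner_diff_left)
  then have "(norm (P x))\<^sup>2 \<le> norm x * norm (P x)" for x
    by (metis power2_norm_eq_inner norm_cauchy_schwarz)
  then have "norm (P x) \<le> norm x" for x
    by (cases "P x = 0") (use mult_right_le_imp_le[of "norm (P x)" "norm (P x)" "norm x"] in \<open>simp_all add: power2_eq_square\<close>)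
  moreover have "bounded_linear P"
    unfolding P_def by (intro bounded_linear_sum bounded_linear_scaleR_const bounded_linear_inner_left)
  ultimately show thesis
    using that[of P] PL id by (simp add: P_def)
qed

section \<open>Mean values along segments and symmetry of the Hessian\<close>

lemma mvt_line:
  fixes F :: "'e::real_normed_vector \<Rightarrow> real"
  assumes "0 < s" and F: "\<And>a. 0 \<le> a \<Longrightarrow> a \<le> s \<Longrightarrow> F differentiable (at (x + a *\<^sub>R v))"
  obtains a where "0 < a" "a < s"
    "F (x + s *\<^sub>R v) - F x = s * frechet_derivative F (at (x + a *\<^sub>R v)) v"
proof -
  have der: "((\<lambda>a. F (x + a *\<^sub>R v)) has_derivative (\<lambda>h. frechet_derivative F (at (x + a *\<^sub>R v)) (h *\<^sub>R v)))
      (at a within {0..s})" if "0 \<le> a" "a \<le> s" for a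
  proof -
    have 1: "((\<lambda>a. x + a *\<^sub>R v) has_derivative (\<lambda>h. h *\<^sub>R v)) (at a within {0..s})"
      by (auto intro!: derivative_eq_intros)
    have 2: "(F has_derivative frechet_derivative F (at (x + a *\<^sub>R v))) (at (x + a *\<^sub>R v))"
      using F[OF that] by (simp add: frechet_derivative_works)
    show ?thesis
      using has_derivative_compose[OF 1 2] .
  qed
  obtain a where a: "a \<in> {0<..<s}"
    "F (x + s *\<^sub>R v) - F (x + 0 *\<^sub>R v) = frechet_derivative F (at (x + a *\<^sub>R v)) ((s - 0) *\<^sub>R v)"
    using mvt_simple[OF \<open>0 < s\<close> der] by blast
  have "linear (frechet_derivative F (at (x + a *\<^sub>R v)))"
    using F[of a] a by (auto intro: linear_frechet_derivative)
  then show thesis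
    using that[of a] a by (simp add: linear_cmul)
qed

text \<open>Both mixed derivatives arise as limits of the second difference quotient
  $(F(x+sv+sw) - F(x+sv) - F(x+sw) + F(x)) / s^2$.\<close>

lemma second_difference_mvt:
  fixes F :: "'e::real_normed_vector \<Rightarrow> real"
  assumes s: "0 < s"
    and F: "\<And>a b. 0 \<le> a \<Longrightarrow> a \<le> s \<Longrightarrow> 0 \<le> b \<Longrightarrow> b \<le> s \<Longrightarrow> F differentiable (at (x + a *\<^sub>R v + b *\<^sub>R w))"
    and F2: "\<And>a b. 0 \<le> a \<Longrightarrow> a \<le> s \<Longrightarrow> 0 \<le> b \<Longrightarrow> b \<le> s \<Longrightarrow>
        (\<lambda>y. frechet_derivative F (at y) v) differentiable (at (x + a *\<^sub>R v + b *\<^sub>R w))"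
  obtains a b where "0 < a" "a < s" "0 < b" "b < s"
    "F (x + s *\<^sub>R v + s *\<^sub>R w) - F (x + s *\<^sub>R v) - F (x + s *\<^sub>R w) + F x =
       s\<^sup>2 * frechet_derivative (\<lambda>y. frechet_derivative F (at y) v) (at (x + a *\<^sub>R v + b *\<^sub>R w)) w"
proof -
  \<comment> \<open>The mean value theorem is applied twice: along \<open>v\<close> to the increment
    \<open>G\<close> of \<open>F\<close> in direction \<open>w\<close>, then along \<open>w\<close>
    to the derivative of \<open>F\<close> in direction \<open>v\<close>.\<close>
  define G where "G y = F (y + s *\<^sub>R w) - F y" for y
  have der: "(G has_derivative (\<lambda>h. frechet_derivative F (at (y + s *\<^sub>R w)) h - frechet_derivative F (at y) h)) (at y)"
    if y: "y = x + a *\<^sub>R v" "0 \<le> a" "a \<le> s" for y a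
  proof -
    have 1: "((\<lambda>y. y + s *\<^sub>R w) has_derivative (\<lambda>h. h)) (at y)"
      by (auto intro!: derivative_eq_intros)
    have 2: "(F has_derivative frechet_derivative F (at (y + s *\<^sub>R w))) (at (y + s *\<^sub>R w))"
      using F[of a s] s y by (simp add: frechet_derivative_works)
    have 3: "(F has_derivative frechet_derivative F (at y)) (at y)"
      using F[of a 0] s y by (simp add: frechet_derivative_works)
    show ?thesis
      unfolding G_def using has_derivative_diff[OF has_derivative_compose[OF 1 2] 3] .
  qed
  have fd: "frechet_derivative G (at (x + a *\<^sub>R v)) =
     (\<lambda>h. frechet_derivative F (at (x + a *\<^sub>R v + s *\<^sub>R w)) h - frechet_derivative F (at (x + a *\<^sub>R v)) h)"
    if "0 \<le> a" "a \<le> s" for a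
    using der[OF refl that] frechet_derivative_at by metis
  obtain a where a: "0 < a" "a < s"
    and G: "G (x + s *\<^sub>R v) - G x = s * frechet_derivative G (at (x + a *\<^sub>R v)) v"
    by (rule mvt_line[of s G x v]) (use s der in \<open>auto simp: differentiable_def\<close>)
  obtain b where b: "0 < b" "b < s"
    and D: "frechet_derivative F (at (x + a *\<^sub>R v + s *\<^sub>R w)) v - frechet_derivative F (at (x + a *\<^sub>R v)) v
      = s * frechet_derivative (\<lambda>y. frechet_derivative F (at y) v) (at (x + a *\<^sub>R v + b *\<^sub>R w)) w"
    by (rule mvt_line[of s "\<lambda>y. frechet_derivative F (at y) v" "x + a *\<^sub>R v" w]) (use s a F2 in auto)
  show thesis
    by (rule that[OF a b]) (use G a in \<open>simp only: fd D less_imp_le, simp add: power2_eq_square G_def algebra_simps\<close>)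
qed

text \<open>Needed because the two sides of the later argument differentiate in opposite orders: the
  mean value theorem yields the derivative of \<open>DF w\<close> in direction \<open>v\<close>,
  while \<open>hessian\<close> in the nondegeneracy condition differentiates \<open>DF v\<close> in
  direction \<open>w\<close>.\<close>

lemma frechet_derivative_symmetric:
  fixes F :: "'e::real_normed_vector \<Rightarrow> real"
  assumes W: "open W" "x \<in> W" and F: "Ck_on 2 W F"
  shows "frechet_derivative (\<lambda>y. frechet_derivative F (at y) v) (at x) w =
         frechet_derivative (\<lambda>y. frechet_derivative F (at y) w) (at x) v"
proof -
  define H where "H v w y = frechet_derivative (\<lambda>y. frechet_derivative F (at y) v) (at y) w" for v w y
  have F1: "\<And>y. y \<in> W \<Longrightarrow> F differentiable (at y)"
    and F2: "\<And>y v. y \<in> W \<Longrightarrow> (\<lambda>y. frechet_derivative F (at y) v) differentiable (at y)"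
    and F3: "\<And>v w. continuous_on W (H v w)"
    using F by (auto simp: numeral_2_eq_2 H_def)
  have "continuous_on UNIV (\<lambda>(a, b). x + a *\<^sub>R v + b *\<^sub>R w)"
    unfolding case_prod_unfold by (intro continuous_intros)
  then have "open ((\<lambda>(a, b). x + a *\<^sub>R v + b *\<^sub>R w) -` W)"
    using W(1) continuous_on_open_vimage[of UNIV] by auto
  moreover have "(0, 0) \<in> (\<lambda>(a, b). x + a *\<^sub>R v + b *\<^sub>R w) -` W"
    using W by simp
  ultimately obtain A B where AB: "open A" "open B" "0 \<in> A" "0 \<in> B"
    "A \<times> B \<subseteq> (\<lambda>(a, b). x + a *\<^sub>R v + b *\<^sub>R w) -` W"
    by (rule open_prod_elim) auto
  then have "open (A \<inter> B)" "0 \<in> A \<inter> B"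
    by auto
  then obtain e where e: "0 < e" "ball 0 e \<subseteq> A \<inter> B"
    using open_contains_ball by metis
  have inW: "x + a *\<^sub>R v + b *\<^sub>R w \<in> W" if "0 \<le> a" "a < e" "0 \<le> b" "b < e" for a b
  proof -
    have "a \<in> A" "b \<in> B"
      using that e by (auto simp: dist_norm subset_iff)
    then show ?thesis
      using AB by auto
  qed
  \<comment> \<open>The exponent \<open>Suc n\<close> keeps every term, including the one for
    \<open>n = 0\<close>, strictly below \<open>e\<close>, so that all parallelograms lie in
    \<open>W\<close>.\<close>
  define s where "s n = e * (1/2) ^ Suc n" for n
  have s: "0 < s n" "s n < e" for n
    using e power_Suc_less_one[of "1/2::real" n] by (auto simp: s_def mult_less_cancel_left1)
  have s0: "s \<longlonglongrightarrow> 0"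
    unfolding s_def by (intro tendsto_mult_right_zero LIMSEQ_Suc LIMSEQ_power_zero) simp
  have m: "x + a *\<^sub>R v + b *\<^sub>R w \<in> W" if "0 \<le> a" "a \<le> s n" "0 \<le> b" "b \<le> s n" for a b n
    using inW[of a b] that s(2)[of n] by linarith
  have m': "x + b *\<^sub>R w + a *\<^sub>R v \<in> W" if "0 \<le> a" "a \<le> s n" "0 \<le> b" "b \<le> s n" for a b n
    using m[OF that] by (simp add: ac_simps)
  have key: "\<exists>a b. 0 < a \<and> a < s n \<and> 0 < b \<and> b < s n \<and>
      F (x + s n *\<^sub>R v + s n *\<^sub>R w) - F (x + s n *\<^sub>R v) - F (x + s n *\<^sub>R w) + F x =
       (s n)\<^sup>2 * H v w (x + a *\<^sub>R v + b *\<^sub>R w)" for n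
    by (rule second_difference_mvt[of "s n" F x v w])
       (use m[of _ n] s(1)[of n] in \<open>simp_all add: F1 F2 H_def, blast?\<close>)
  have key': "\<exists>b a. 0 < b \<and> b < s n \<and> 0 < a \<and> a < s n \<and>
      F (x + s n *\<^sub>R w + s n *\<^sub>R v) - F (x + s n *\<^sub>R w) - F (x + s n *\<^sub>R v) + F x =
       (s n)\<^sup>2 * H w v (x + b *\<^sub>R w + a *\<^sub>R v)" for n
    by (rule second_difference_mvt[of "s n" F x w v])
       (use m'[of _ n] s(1)[of n] in \<open>simp_all add: F1 F2 H_def, blast?\<close>)
  obtain a b where ab: "\<And>n. 0 < a n \<and> a n < s n \<and> 0 < b n \<and> b n < s n \<and>
      F (x + s n *\<^sub>R v + s n *\<^sub>R w) - F (x + s n *\<^sub>R v) - F (x + s n *\<^sub>R w) + F x =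
       (s n)\<^sup>2 * H v w (x + a n *\<^sub>R v + b n *\<^sub>R w)"
    using key by metis
  obtain b' a' where ab': "\<And>n. 0 < b' n \<and> b' n < s n \<and> 0 < a' n \<and> a' n < s n \<and>
      F (x + s n *\<^sub>R w + s n *\<^sub>R v) - F (x + s n *\<^sub>R w) - F (x + s n *\<^sub>R v) + F x =
       (s n)\<^sup>2 * H w v (x + b' n *\<^sub>R w + a' n *\<^sub>R v)"
    using key' by metis
  have to0: "u \<longlonglongrightarrow> 0" if "\<And>n. 0 < u n \<and> u n < s n" for u
    by (rule tendsto_sandwich[OF _ _ tendsto_const s0]) (use that in \<open>simp_all add: less_imp_le\<close>)
  have "a \<longlonglongrightarrow> 0" "b \<longlonglongrightarrow> 0" "a' \<longlonglongrightarrow> 0" "b' \<longlonglongrightarrow> 0"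
    using ab ab' by (auto intro!: to0)
  then have lim: "(\<lambda>n. x + a n *\<^sub>R v + b n *\<^sub>R w) \<longlonglongrightarrow> x" "(\<lambda>n. x + b' n *\<^sub>R w + a' n *\<^sub>R v) \<longlonglongrightarrow> x"
    by (auto intro!: tendsto_eq_intros)
  have "isCont (H v w) x" "isCont (H w v) x"
    using F3 W continuous_on_eq_continuous_at by blast+
  then have l: "(\<lambda>n. H v w (x + a n *\<^sub>R v + b n *\<^sub>R w)) \<longlonglongrightarrow> H v w x"
    "(\<lambda>n. H w v (x + b' n *\<^sub>R w + a' n *\<^sub>R v)) \<longlonglongrightarrow> H w v x"
    using lim isCont_tendsto_compose by blast+
  \<comment> \<open>The second difference is symmetric in \<open>v\<close> and \<open>w\<close>, so
    both mean value forms describe the same number; the positive factor cancels before passing to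
    the limit.\<close>
  have "(s n)\<^sup>2 * H v w (x + a n *\<^sub>R v + b n *\<^sub>R w) = (s n)\<^sup>2 * H w v (x + b' n *\<^sub>R w + a' n *\<^sub>R v)" for n
    using ab[of n] ab'[of n] by (simp add: algebra_simps)
  then have "H v w (x + a n *\<^sub>R v + b n *\<^sub>R w) = H w v (x + b' n *\<^sub>R w + a' n *\<^sub>R v)" for n
    using s(1)[of n] by (metis less_irrefl mult_cancel_left power_eq_0_iff)
  with l have "H v w x = H w v x"
    using LIMSEQ_unique by simp
  then show ?thesis
    by (simp add: H_def)
qed


text \<open>If critical points \<open>x\<^sub>n \<notin> L\<close> converged to \<open>x0\<close>, the mean value theorem on the segments from the
  projections \<open>P x\<^sub>n\<close> to \<open>x\<^sub>n\<close> would make a limit of the unit normals \<open>(x\<^sub>n - P x\<^sub>n) / |x\<^sub>n - P x\<^sub>n|\<close>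
  Hessian-orthogonal to everything.\<close>

lemma nondegenerate_critical_set_local:
  fixes F :: "'e::{real_inner,heine_borel} \<Rightarrow> real"
  assumes W: "open W" "x0 \<in> W" and L: "subspace L" "x0 \<in> L" and F: "Ck_on 2 W F"
    and crit: "\<And>x. x \<in> W \<inter> L \<Longrightarrow> frechet_derivative F (at x) = (\<lambda>v. 0)"
    and nondeg: "\<And>v. (\<And>w. frechet_derivative (\<lambda>x. frechet_derivative F (at x) v) (at x0) w = 0) \<Longrightarrow> v \<in> L"
  obtains r where "0 < r" "ball x0 r \<subseteq> W"
    "\<And>x. x \<in> ball x0 r \<Longrightarrow> frechet_derivative F (at x) = (\<lambda>v. 0) \<Longrightarrow> x \<in> L"
proof -
  obtain P where P: "bounded_linear P" and PL: "\<And>x. P x \<in> L"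
    and Pid: "\<And>x. x \<in> L \<Longrightarrow> P x = x" and Pn: "\<And>x. norm (P x) \<le> norm x"
    using subspace_projection_exists[OF L(1)] by blast
  interpret P: bounded_linear P by (rule P)
  obtain B :: "'e set" where B: "\<forall>x\<in>UNIV. (\<Sum>b\<in>B. (x \<bullet> b) *\<^sub>R b) = x"
    using orthonormal_basis_exists[OF subspace_UNIV] by (elim exE conjE) (rule that)
  obtain e where e: "0 < e" "ball x0 e \<subseteq> W"
    using W open_contains_ball by metis
  have F2: "\<And>y v. y \<in> W \<Longrightarrow> (\<lambda>y. frechet_derivative F (at y) v) differentiable (at y)"
    and F3: "\<And>v w. continuous_on W (\<lambda>y. frechet_derivative (\<lambda>y. frechet_derivative F (at y) v) (at y) w)"
    using F by (auto simp: numeral_2_eq_2)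
  define rr where "rr n = e * (1/2) ^ Suc n" for n
  have rr: "0 < rr n" "rr n < e" for n
    using e power_Suc_less_one[of "1/2::real" n] by (auto simp: rr_def mult_less_cancel_left1)
  have rr0: "rr \<longlonglongrightarrow> 0"
    unfolding rr_def by (intro tendsto_mult_right_zero LIMSEQ_Suc LIMSEQ_power_zero) simp
  have "\<exists>n. \<forall>x \<in> ball x0 (rr n). frechet_derivative F (at x) = (\<lambda>v. 0) \<longrightarrow> x \<in> L"
  proof (rule ccontr)
    assume "\<not> ?thesis"
    then have "\<forall>n. \<exists>x. x \<in> ball x0 (rr n) \<and> frechet_derivative F (at x) = (\<lambda>v. 0) \<and> x \<notin> L"
      by blast
    then obtain x where x: "\<And>n. x n \<in> ball x0 (rr n)" and cx: "\<And>n. frechet_derivative F (at (x n)) = (\<lambda>v. 0)"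
      and xL: "\<And>n. x n \<notin> L"
      by metis
    define u where "u n = x n - P (x n)" for n
    define v where "v n = u n /\<^sub>R norm (u n)" for n
    have u0: "u n \<noteq> 0" for n
      using xL[of n] PL[of "x n"] by (auto simp: u_def)
    then have nv: "norm (v n) = 1" for n
      by (simp add: v_def)
    have Pv: "P (v n) = 0" for n
      by (simp add: v_def u_def P.scaleR P.diff Pid PL)
    \<comment> \<open>\<open>P\<close> fixes the centre \<open>x0\<close> and does not increase
      norms, so the foot of the perpendicular stays in the same ball, and with it the whole
      segment.\<close>
    have Px: "P (x n) \<in> ball x0 (rr n)" for n
    proof -
      have "dist x0 (P (x n)) = norm (P (x0 - x n))"
        by (simp add: dist_norm P.diff Pid L)
      also have "\<dots> \<le> dist x0 (x n)"
        by (simp add: dist_norm Pn)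
      finally show ?thesis
        using x[of n] by simp
    qed
    have ballW: "ball x0 (rr n) \<subseteq> W" for n
      using rr(2)[of n] e by (auto simp: subset_iff)
    obtain l k where k: "strict_mono (k :: nat \<Rightarrow> nat)" and l: "(v \<circ> k) \<longlonglongrightarrow> l"
      using compact_cball[of "0::'e" 1] nv unfolding compact_def by (auto dest!: spec[of _ v])
    have nl: "norm l = 1"
      using tendsto_norm[OF l] nv by (simp add: o_def LIMSEQ_const_iff)
    have "(\<lambda>n. P ((v \<circ> k) n)) \<longlonglongrightarrow> P l"
      by (intro P.tendsto l)
    then have Pl: "P l = 0"
      by (simp add: Pv LIMSEQ_const_iff)
    \<comment> \<open>The subsequence \<open>k\<close> and the limit \<open>l\<close> are fixed
      before \<open>w\<close>, so one vector is orthogonal to every \<open>w\<close>; the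
      intermediate points \<open>z n\<close> may depend on \<open>w\<close>.\<close>
    have "frechet_derivative (\<lambda>y. frechet_derivative F (at y) l) (at x0) w = 0" for w
    proof -
      define G where "G = (\<lambda>y. frechet_derivative F (at y) w)"
      have lin: "linear (frechet_derivative G (at y))" if "y \<in> W" for y
        unfolding G_def using that by (intro linear_frechet_derivative F2)
      have "\<exists>z \<in> ball x0 (rr n). frechet_derivative G (at z) (v n) = 0" for n
      proof -
        have seg: "P (x n) + a *\<^sub>R u n \<in> ball x0 (rr n)" if "0 \<le> a" "a \<le> 1" for a
        proof -
          have "(1 - a) *\<^sub>R P (x n) + a *\<^sub>R x n \<in> ball x0 (rr n)"
            using that x[of n] Px[of n] by (intro convexD[OF convex_ball]) auto
          then show ?thesis
            by (simp add: u_def algebra_simps)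
        qed
        have diff: "G differentiable at (P (x n) + a *\<^sub>R u n)" if "0 \<le> a" "a \<le> 1" for a
          unfolding G_def using seg[OF that] ballW by (intro F2) (rule subsetD)
        obtain a where a: "0 < a" "a < 1"
          "G (P (x n) + 1 *\<^sub>R u n) - G (P (x n)) = 1 * frechet_derivative G (at (P (x n) + a *\<^sub>R u n)) (u n)"
          by (rule mvt_line[OF zero_less_one diff])
        have "P (x n) \<in> W \<inter> L"
          using Px[of n] ballW[of n] PL by blast
        then have "G (P (x n)) = 0" "G (x n) = 0"
          using crit[of "P (x n)"] cx[of n] by (auto simp: G_def)
        then have "frechet_derivative G (at (P (x n) + a *\<^sub>R u n)) (u n) = 0"
          using a by (simp add: u_def)
        moreover have zb: "P (x n) + a *\<^sub>R u n \<in> ball x0 (rr n)"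
          using seg[of a] a by simp
        then have "linear (frechet_derivative G (at (P (x n) + a *\<^sub>R u n)))"
          using lin ballW by blast
        ultimately have "frechet_derivative G (at (P (x n) + a *\<^sub>R u n)) (v n) = 0"
          by (simp add: v_def linear_cmul)
        with zb show ?thesis
          by blast
      qed
      then obtain z where z: "\<And>n. z n \<in> ball x0 (rr n)" and Gz: "\<And>n. frechet_derivative G (at (z n)) (v n) = 0"
        by metis
      \<comment> \<open>Continuity of second derivatives is known only for fixed directions.
        Expanding the moving direction in the finite basis \<open>B\<close> allows point and
        direction to converge simultaneously.\<close>
      have expand: "frechet_derivative G (at y) q = (\<Sum>b\<in>B. (q \<bullet> b) * frechet_derivative G (at y) b)"
        if "y \<in> W" for y q
        by (subst (1) B[THEN bspec, OF UNIV_I, symmetric]) (simp add: linear_sum[OF lin[OF that]] linear_cmul[OF lin[OF that]])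
      have "z \<longlonglongrightarrow> x0"
      proof (rule tendstoI)
        fix \<epsilon> :: real assume "0 < \<epsilon>"
        then have "\<forall>\<^sub>F n in sequentially. rr n < \<epsilon>"
          using rr0 by (rule order_tendstoD(2)[rotated])
        then show "\<forall>\<^sub>F n in sequentially. dist (z n) x0 < \<epsilon>"
          by eventually_elim (use z in \<open>auto simp: dist_commute intro: less_trans\<close>)
      qed
      then have zk: "(\<lambda>n. z (k n)) \<longlonglongrightarrow> x0"
        using LIMSEQ_subseq_LIMSEQ[OF _ k] by (fastforce simp: o_def)
      have "isCont (\<lambda>y. frechet_derivative G (at y) b) x0" for b
        using F3[of w b] W continuous_on_eq_continuous_at unfolding G_def by blast
      then have "(\<lambda>n. \<Sum>b\<in>B. (v (k n) \<bullet> b) * frechet_derivative G (at (z (k n))) b)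
          \<longlonglongrightarrow> (\<Sum>b\<in>B. (l \<bullet> b) * frechet_derivative G (at x0) b)"
        using l unfolding o_def
        by (intro tendsto_sum tendsto_mult[OF tendsto_inner[OF _ tendsto_const] isCont_tendsto_compose[OF _ zk]])
      moreover have "(\<Sum>b\<in>B. (v (k n) \<bullet> b) * frechet_derivative G (at (z (k n))) b) = 0" for n
        using expand[of "z (k n)" "v (k n)"] Gz[of "k n"] z[of "k n"] ballW[of "k n"] by (simp add: subset_iff)
      ultimately have "frechet_derivative G (at x0) l = 0"
        using expand[OF W(2), of l] by (simp add: LIMSEQ_const_iff)
      then show ?thesis
        unfolding G_def using frechet_derivative_symmetric[OF W F] by metis
    qed
    then have "l \<in> L"
      by (rule nondeg)
    then show False
      using Pid[of l] Pl nl by simp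
  qed
  then obtain n where "\<forall>x \<in> ball x0 (rr n). frechet_derivative F (at x) = (\<lambda>v. 0) \<longrightarrow> x \<in> L"
    by blast
  then show thesis
    using that[of "rr n"] rr[of n] e by (auto simp: subset_iff)
qed

section \<open>Pushes supported in a chart\<close>

lemma is_chartD:
  fixes \<phi> :: "'m \<Rightarrow> 'e::{real_inner,heine_borel}"
  assumes "is_chart M (U, \<phi>)"
  shows "openin M U" "U \<subseteq> topspace M" "open (\<phi> ` U)" "inj_on \<phi> U"
    "continuous_map (subtopology M U) euclidean \<phi>"
    "continuous_map (top_of_set (\<phi> ` U)) M (inv_into U \<phi>)"
proof -
  have U: "openin M U" and o: "open (\<phi> ` U)" and hom: "homeomorphic_map (subtopology M U) (top_of_set (\<phi> ` U)) \<phi>"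
    using assms by (auto simp: is_chart_def)
  then have sub: "U \<subseteq> topspace M"
    by (simp add: openin_subset)
  then have ts: "topspace (subtopology M U) = U"
    by auto
  obtain \<psi> where \<psi>: "homeomorphic_maps (subtopology M U) (top_of_set (\<phi> ` U)) \<phi> \<psi>"
    using hom by (auto simp: homeomorphic_map_maps)
  have inj: "inj_on \<phi> U"
    using homeomorphic_imp_injective_map[OF hom] ts by simp
  have "continuous_map (top_of_set (\<phi> ` U)) M \<psi>"
    using \<psi> continuous_map_into_fulltopology unfolding homeomorphic_maps_def by metis
  then have "continuous_map (top_of_set (\<phi> ` U)) M (inv_into U \<phi>)"
  proof (rule continuous_map_eq)
    fix x assume "x \<in> topspace (top_of_set (\<phi> ` U))"
    then obtain q where "q \<in> U" "x = \<phi> q"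
      by auto
    then show "\<psi> x = inv_into U \<phi> x"
      using \<psi> inj sub by (auto simp: homeomorphic_maps_def)
  qed
  moreover have "continuous_map (subtopology M U) euclidean \<phi>"
    using homeomorphic_imp_continuous_map[OF hom] continuous_map_into_fulltopology by metis
  ultimately show "openin M U" "U \<subseteq> topspace M" "open (\<phi> ` U)" "inj_on \<phi> U"
    "continuous_map (subtopology M U) euclidean \<phi>"
    "continuous_map (top_of_set (\<phi> ` U)) M (inv_into U \<phi>)"
    using U o sub inj by simp_all
qed

lemma openin_chart_preimage:
  assumes chart: "is_chart M (U, \<phi>)" and "open B"
  shows "openin M {q \<in> U. \<phi> q \<in> B}"
proof -
  have "openin (subtopology M U) {q \<in> topspace (subtopology M U). \<phi> q \<in> B}"
    using is_chartD(5)[OF chart] \<open>open B\<close> by (intro openin_continuous_map_preimage[of _ euclidean]) auto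
  then show ?thesis
    using is_chartD(1,2)[OF chart]
    by (simp add: openin_open_subtopology Collect_conj_eq Int_absorb1 flip: Int_assoc)
qed

text \<open>The preimage is the image of \<open>C\<close> under the inverse chart, hence compact.
  The Hausdorff property makes it closed in all of M and not just in \<open>U\<close>, as gluing
  with the identity outside the chart requires.\<close>

lemma closedin_chart_preimage_compact:
  assumes M: "Hausdorff_space M" and chart: "is_chart M (U, \<phi>)" and C: "compact C" "C \<subseteq> \<phi> ` U"
  shows "closedin M {q \<in> U. \<phi> q \<in> C}"
proof -
  have "{q \<in> U. \<phi> q \<in> C} = inv_into U \<phi> ` C"
  proof (intro equalityI subsetI)
    fix q assume "q \<in> {q \<in> U. \<phi> q \<in> C}"
    then show "q \<in> inv_into U \<phi> ` C"
      using is_chartD(4)[OF chart] by (intro image_eqI[of _ _ "\<phi> q"]) auto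
  next
    fix q assume "q \<in> inv_into U \<phi> ` C"
    then obtain x where "x \<in> C" "q = inv_into U \<phi> x"
      by auto
    then show "q \<in> {q \<in> U. \<phi> q \<in> C}"
      using C(2) inv_into_into[of x \<phi> U] f_inv_into_f[of x \<phi> U] by auto
  qed
  moreover have "compactin (top_of_set (\<phi> ` U)) C"
    using C by (simp add: compactin_subtopology)
  then have "compactin M (inv_into U \<phi> ` C)"
    using is_chartD(6)[OF chart] by (rule image_compactin)
  ultimately show ?thesis
    using M by (simp add: compactin_imp_closedin)
qed

text \<open>\<open>G\<close> read in the chart is glued to the constant homotopy outside the ball.
  The two agree over the bounding sphere because \<open>G\<close> is the identity there at all
  times.\<close>

lemma chart_extension_homotopic_id:
  fixes \<phi> :: "'m \<Rightarrow> 'e::{real_inner,heine_borel}"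
  assumes M: "Hausdorff_space M" and chart: "is_chart M (U, \<phi>)" and sub: "cball x0 r \<subseteq> \<phi> ` U"
    and contG: "continuous_on ({0..1} \<times> cball x0 r) G"
    and Gim: "\<And>t x. t \<in> {0..1} \<Longrightarrow> x \<in> cball x0 r \<Longrightarrow> G (t, x) \<in> cball x0 r"
    and G0: "\<And>x. x \<in> cball x0 r \<Longrightarrow> G (0, x) = x"
    and Gr: "\<And>t x. t \<in> {0..1} \<Longrightarrow> dist x0 x = r \<Longrightarrow> G (t, x) = x"
  shows "homotopic_with (\<lambda>_. True) M M id
           (\<lambda>q. if q \<in> U \<and> \<phi> q \<in> cball x0 r then inv_into U \<phi> (G (1::real, \<phi> q)) else q)"
proof -
  note ch = is_chartD[OF chart]
  define C where "C = {q \<in> U. \<phi> q \<in> cball x0 r}"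
  define O' where "O' = {q \<in> U. \<phi> q \<in> ball x0 r}"
  define X where "X = prod_topology (top_of_set {0..1::real}) M"
  define H where "H z = (if snd z \<in> C then inv_into U \<phi> (G (fst z, \<phi> (snd z))) else snd z)" for z
  \<comment> \<open>A closed cover of the cylinder: over the closed ball for \<open>True\<close>,
    over the complement of the open ball for \<open>False\<close>. The two pieces meet exactly over
    the sphere.\<close>
  define T where "T b = {z \<in> topspace X. snd z \<in> (if b then C else topspace M - O')}" for b
  have sndX: "continuous_map X M snd"
    unfolding X_def by (rule continuous_map_snd)
  have clC: "closedin M C"
    unfolding C_def by (rule closedin_chart_preimage_compact[OF M chart _ sub]) simp
  have opO: "openin M O'"
    unfolding O'_def by (rule openin_chart_preimage[OF chart]) simp
  have CU: "C \<subseteq> U"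
    by (auto simp: C_def)
  have topX: "topspace X = {0..1} \<times> topspace M"
    by (simp add: X_def)
  have "continuous_map X M H"
  proof (rule pasting_lemma_closed[of "{True, False}" X T M
        "\<lambda>b. if b then \<lambda>z. inv_into U \<phi> (G (fst z, \<phi> (snd z))) else snd"])
    show "closedin X (T b)" if "b \<in> {True, False}" for b
      unfolding T_def
      by (rule closedin_continuous_map_preimage[OF sndX]) (use clC opO in \<open>auto simp: closedin_def\<close>)
    show "continuous_map (subtopology X (T b)) M (if b then \<lambda>z. inv_into U \<phi> (G (fst z, \<phi> (snd z))) else snd)"
      if "b \<in> {True, False}" for b
    proof (cases b)
      case False
      then show ?thesis
        using sndX by (simp add: continuous_map_from_subtopology)
    next
      case True
      have top: "topspace (subtopology X (T True)) = {0..1} \<times> C"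
        using CU ch(2) by (auto simp: T_def topX)
      have 1: "continuous_map (subtopology X (T True)) euclidean fst"
        unfolding X_def
        by (rule continuous_map_from_subtopology, rule continuous_map_into_fulltopology, rule continuous_map_fst)
      have 2: "continuous_map (subtopology X (T True)) (subtopology M U) snd"
        using CU unfolding continuous_map_in_subtopology top
        by (auto intro: continuous_map_from_subtopology sndX)
      have 3: "continuous_map (subtopology X (T True)) euclidean (\<lambda>z. \<phi> (snd z))"
        using continuous_map_compose[OF 2 ch(5)] by (simp add: o_def)
      have "continuous_map (subtopology X (T True)) euclidean (\<lambda>z. (fst z, \<phi> (snd z)))"
        using continuous_map_pairedI[OF 1 3] by simp
      then have 4: "continuous_map (subtopology X (T True)) (top_of_set ({0..1} \<times> cball x0 r)) (\<lambda>z. (fst z, \<phi> (snd z)))"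
        unfolding continuous_map_in_subtopology top by (auto simp: C_def)
      have 5: "continuous_map (top_of_set ({0..1} \<times> cball x0 r)) (top_of_set (\<phi> ` U)) G"
        using contG Gim sub by (auto simp: continuous_map_in_subtopology Pi_iff subset_iff)
      have "continuous_map (subtopology X (T True)) M (\<lambda>z. inv_into U \<phi> (G (fst z, \<phi> (snd z))))"
        using continuous_map_compose[OF continuous_map_compose[OF 4 5] ch(6)] by (simp add: o_def)
      with True show ?thesis
        by simp
    qed
    have bd: "inv_into U \<phi> (G (fst z, \<phi> (snd z))) = snd z"
      if "z \<in> topspace X" "snd z \<in> C" "snd z \<notin> O'" for z
    proof -
      have "dist x0 (\<phi> (snd z)) = r" "fst z \<in> {0..1}" "snd z \<in> U"
        using that by (auto simp: C_def O'_def topX)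
      then show ?thesis
        using ch(4) by (simp add: Gr)
    qed
    show "(if b then \<lambda>z. inv_into U \<phi> (G (fst z, \<phi> (snd z))) else snd) z =
          (if b' then \<lambda>z. inv_into U \<phi> (G (fst z, \<phi> (snd z))) else snd) z"
      if "b \<in> {True, False}" "b' \<in> {True, False}" "z \<in> topspace X \<inter> T b \<inter> T b'" for b b' z
      using that(3) bd[of z] by (cases b; cases b') (auto simp: T_def)
    show "\<exists>b. b \<in> {True, False} \<and> z \<in> T b \<and>
        H z = (if b then \<lambda>z. inv_into U \<phi> (G (fst z, \<phi> (snd z))) else snd) z"
      if "z \<in> topspace X" for z
    proof (intro exI[of _ "snd z \<in> C"] conjI)
      show "z \<in> T (snd z \<in> C)"
        using that by (auto simp: T_def topX C_def O'_def)
    qed (auto simp: H_def)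
  qed simp
  moreover have "H (0, q) = id q" if "q \<in> topspace M" for q
    using ch(4) by (auto simp: H_def C_def G0)
  moreover have "H (1, q) = (if q \<in> U \<and> \<phi> q \<in> cball x0 r then inv_into U \<phi> (G (1, \<phi> q)) else q)" for q
    by (simp add: H_def C_def)
  ultimately show ?thesis
    unfolding homotopic_with[of M "\<lambda>_. True", OF refl] X_def by (intro exI[of _ H]) auto
qed

section \<open>Composition of pushes and pullback of homotopies\<close>

lemma homotopic_id_compose:
  assumes h: "homotopic_with (\<lambda>_. True) M M id h" and k: "homotopic_with (\<lambda>_. True) M M id k"
  shows "homotopic_with (\<lambda>_. True) M M id (k \<circ> h)"
proof -
  have "continuous_map M M k"
    using homotopic_with_imp_continuous_maps[OF k] by simp
  with h have "homotopic_with (\<lambda>_. True) M M (k \<circ> id) (k \<circ> h)"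
    by (rule homotopic_with_compose_continuous_map_left) simp
  then show ?thesis
    using homotopic_with_trans[OF k] by simp
qed

lemma homotopic_id_continuous: "homotopic_with (\<lambda>_. True) M M id h \<Longrightarrow> continuous_map M M h"
  using homotopic_with_imp_continuous_maps by blast

text \<open>Over \<open>W\<close> there is a chain f, f after h, g after h, g. The outer links use
  the homotopy from the identity to \<open>h\<close>, which may leave \<open>W\<close> because f and
  g are defined on all of M; the middle link uses that \<open>h\<close> maps \<open>W\<close> into
  \<open>V\<close>.\<close>

lemma homotopic_on_pullback:
  assumes h: "homotopic_with (\<lambda>_. True) M M id h"
    and f: "continuous_map M Y f" and g: "continuous_map M Y g"
    and fg: "homotopic_with (\<lambda>_. True) (subtopology M V) Y f g"
    and W: "h \<in> topspace M \<inter> W \<rightarrow> V"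
  shows "homotopic_with (\<lambda>_. True) (subtopology M W) Y f g"
proof -
  have "continuous_map (subtopology M W) (subtopology M V) h"
    using W homotopic_id_continuous[OF h]
    by (simp add: continuous_map_in_subtopology continuous_map_from_subtopology)
  with fg have 1: "homotopic_with (\<lambda>_. True) (subtopology M W) Y (f \<circ> h) (g \<circ> h)"
    by (rule homotopic_with_compose_continuous_map_right) simp
  have 2: "homotopic_with (\<lambda>_. True) (subtopology M W) Y k (k \<circ> h)" if k: "continuous_map M Y k" for k
  proof -
    have "homotopic_with (\<lambda>_. True) M Y (k \<circ> id) (k \<circ> h)"
      using h k by (rule homotopic_with_compose_continuous_map_left) simp
    then show ?thesis
      by (simp add: homotopic_from_subtopology)
  qed
  show ?thesis
    using homotopic_with_trans[OF homotopic_with_trans[OF 2[OF f] 1] homotopic_with_symD[OF 2[OF g]]] .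
qed

section \<open>The two local constructions: lowering \<Phi> and projecting to a slice\<close>

text \<open>A direction \<open>v\<close> of negative derivative at \<open>p\<close> remains one on a
  small ball. Translating along \<open>v\<close>, with a step that shrinks to zero at the sphere,
  keeps every trajectory inside that ball, so the mean value theorem gives strict decrease on its
  interior.\<close>

lemma descending_push_exists:
  fixes \<phi> :: "'m \<Rightarrow> 'e::{real_inner,heine_borel}"
  assumes M: "Hausdorff_space M" and chart: "is_chart M (U, \<phi>)" and p: "p \<in> U"
    and C1: "Ck_on 1 (\<phi> ` U) (\<Phi> \<circ> inv_into U \<phi>)"
    and noncrit: "frechet_derivative (\<Phi> \<circ> inv_into U \<phi>) (at (\<phi> p)) \<noteq> (\<lambda>v. 0)"
  shows "\<exists>h V. homotopic_with (\<lambda>_. True) M M id h \<and> openin M V \<and> p \<in> V \<and>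
    (\<forall>q. h q = q \<or> \<Phi> (h q) < \<Phi> q) \<and> (\<forall>q\<in>V. \<Phi> (h q) < (\<Phi> q :: real))"
proof -
  note ch = is_chartD[OF chart]
  define F where "F = \<Phi> \<circ> inv_into U \<phi>"
  define x0 where "x0 = \<phi> p"
  have x0: "x0 \<in> \<phi> ` U"
    using p by (simp add: x0_def)
  have F1: "\<And>x. x \<in> \<phi> ` U \<Longrightarrow> F differentiable (at x)"
    and F2: "\<And>v. continuous_on (\<phi> ` U) (\<lambda>x. frechet_derivative F (at x) v)"
    using C1 by (auto simp: F_def)
  obtain v where v: "frechet_derivative F (at x0) v < 0"
  proof -
    obtain w where w: "frechet_derivative F (at x0) w \<noteq> 0"
      using noncrit unfolding F_def x0_def by auto
    have "linear (frechet_derivative F (at x0))"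
      using F1[OF x0] by (rule linear_frechet_derivative)
    then have "frechet_derivative F (at x0) (- w) = - frechet_derivative F (at x0) w"
      by (rule linear_neg)
    with w that[of w] that[of "- w"] show thesis
      by linarith
  qed
  define N where "N = {x \<in> \<phi> ` U. frechet_derivative F (at x) v < 0}"
  have "open N"
  proof -
    have "N = \<phi> ` U \<inter> (\<lambda>x. frechet_derivative F (at x) v) -` {..<0}"
      by (auto simp: N_def)
    then show ?thesis
      using continuous_open_preimage[OF F2 ch(3) open_lessThan] by simp
  qed
  moreover have "x0 \<in> N"
    using x0 v by (simp add: N_def)
  ultimately obtain r where r: "0 < r" "cball x0 r \<subseteq> N"
    using open_contains_cball by metis
  \<comment> \<open>Chosen so that the displacement \<open>a * (r - dist x0 x) * norm v\<close>
    never exceeds the remaining distance to the sphere; the summand 1 keeps the denominator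
    positive.\<close>
  define a where "a = 1 / (1 + norm v)"
  have a: "0 < a" "a * norm v \<le> 1"
    by (auto simp: a_def add_pos_nonneg field_simps)
  define G where "G = (\<lambda>(t::real, x). x + (t * a * (r - dist x0 x)) *\<^sub>R v)"
  have step: "x + s *\<^sub>R v \<in> cball x0 r" if "dist x0 x \<le> r" "0 \<le> s" "s \<le> a * (r - dist x0 x)" for x s
  proof -
    have "dist x0 (x + s *\<^sub>R v) \<le> dist x0 x + dist x (x + s *\<^sub>R v)"
      by (rule dist_triangle)
    also have "dist x (x + s *\<^sub>R v) = s * norm v"
      using that by (simp add: dist_norm)
    also have "\<dots> \<le> (a * norm v) * (r - dist x0 x)"
      using mult_right_mono[OF that(3), of "norm v"] by (simp add: mult_ac)
    also have "\<dots> \<le> r - dist x0 x"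
      using a that by (intro mult_left_le_one_le) auto
    finally show ?thesis
      by simp
  qed
  have sub: "cball x0 r \<subseteq> \<phi> ` U"
    using r by (auto simp: N_def)
  define h where "h = (\<lambda>q. if q \<in> U \<and> \<phi> q \<in> cball x0 r then inv_into U \<phi> (G (1, \<phi> q)) else q)"
  have "homotopic_with (\<lambda>_. True) M M id h"
    unfolding h_def
  proof (rule chart_extension_homotopic_id[OF M chart sub])
    show "continuous_on ({0..1} \<times> cball x0 r) G"
      unfolding G_def case_prod_unfold by (intro continuous_intros)
    show "G (t, x) \<in> cball x0 r" if tx: "t \<in> {0..1}" "x \<in> cball x0 r" for t x
    proof -
      have "t * (a * (r - dist x0 x)) \<le> a * (r - dist x0 x)"
        using tx a by (intro mult_left_le_one_le) auto
      then show ?thesis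
        using tx a step[of x "t * a * (r - dist x0 x)"] by (simp add: G_def mult.assoc)
    qed
  qed (auto simp: G_def)
  moreover have dec: "\<Phi> (h q) < \<Phi> q" if q: "q \<in> U" "\<phi> q \<in> ball x0 r" for q
  proof -
    define s where "s = a * (r - dist x0 (\<phi> q))"
    have s: "0 < s"
      using q a by (simp add: s_def)
    have diff: "F differentiable (at (\<phi> q + b *\<^sub>R v))" if "0 \<le> b" "b \<le> s" for b
      using step[of "\<phi> q" b] that q sub by (intro F1) (auto simp: s_def)
    obtain b where b: "0 < b" "b < s"
      "F (\<phi> q + s *\<^sub>R v) - F (\<phi> q) = s * frechet_derivative F (at (\<phi> q + b *\<^sub>R v)) v"
      by (rule mvt_line[OF s diff])
    have "\<phi> q + b *\<^sub>R v \<in> N"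
      using step[of "\<phi> q" b] b q r by (auto simp: s_def)
    then have "s * frechet_derivative F (at (\<phi> q + b *\<^sub>R v)) v < 0"
      using s by (simp add: N_def mult_pos_neg)
    then have "F (\<phi> q + s *\<^sub>R v) < F (\<phi> q)"
      using b(3) by linarith
    moreover have "F (\<phi> q) = \<Phi> q"
      using q ch(4) by (simp add: F_def)
    moreover have "F (\<phi> q + s *\<^sub>R v) = \<Phi> (h q)"
      using q by (simp add: F_def h_def G_def s_def)
    ultimately show ?thesis
      by simp
  qed
  moreover have "h q = q \<or> \<Phi> (h q) < \<Phi> q" for q
  proof (cases "q \<in> U \<and> \<phi> q \<in> ball x0 r")
    case True
    then show ?thesis
      using dec[of q] by simp
  next
    case False
    then show ?thesis
      using ch(4) by (auto simp: h_def G_def)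
  qed
  moreover have "openin M {q \<in> U. \<phi> q \<in> ball x0 r}"
    by (rule openin_chart_preimage[OF chart]) simp
  moreover have "p \<in> {q \<in> U. \<phi> q \<in> ball x0 r}"
    using p r by (simp add: x0_def)
  ultimately show ?thesis
    by (intro exI[of _ h] exI[of _ "{q \<in> U. \<phi> q \<in> ball x0 r}"]) simp
qed

text \<open>Linear interpolation between the identity and the projection onto \<open>L\<close>,
  damped towards the sphere. It stays in the ball by convexity, fixes the slice because
  \<open>P\<close> does, and is the full projection near the centre.\<close>

lemma slice_push_exists:
  fixes \<phi> :: "'m \<Rightarrow> 'e::{real_inner,heine_borel}"
  assumes M: "Hausdorff_space M" and chart: "is_chart M (U, \<phi>)" and p: "p \<in> U"
    and L: "subspace L" "\<phi> p \<in> L" and R: "0 < R" "ball (\<phi> p) R \<subseteq> \<phi> ` U"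
    and S: "\<And>q. q \<in> U \<Longrightarrow> \<phi> q \<in> ball (\<phi> p) R \<Longrightarrow> q \<in> S \<longleftrightarrow> \<phi> q \<in> L"
  shows "\<exists>h V. homotopic_with (\<lambda>_. True) M M id h \<and> openin M V \<and> p \<in> V \<and>
    (\<forall>q\<in>S. h q = q) \<and> h ` V \<subseteq> S"
proof -
  note ch = is_chartD[OF chart]
  define x0 where "x0 = \<phi> p"
  \<comment> \<open>Halving keeps the closed ball of radius \<open>r\<close> inside the open ball of
    radius \<open>R\<close>, where \<open>S\<close> is known to be the slice.\<close>
  define r where "r = R / 2"
  have r: "0 < r" "r < R"
    using R by (auto simp: r_def)
  obtain P where P: "bounded_linear P" and PL: "\<And>x. P x \<in> L"
    and Pid: "\<And>x. x \<in> L \<Longrightarrow> P x = x" and Pn: "\<And>x. norm (P x) \<le> norm x"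
    using subspace_projection_exists[OF L(1)] by blast
  interpret P: bounded_linear P by (rule P)
  have Pc: "P x \<in> cball x0 r" if "x \<in> cball x0 r" for x
  proof -
    have "dist x0 (P x) = norm (P (x0 - x))"
      using L by (simp add: dist_norm P.diff Pid x0_def)
    also have "\<dots> \<le> dist x0 x"
      by (simp add: dist_norm Pn)
    finally show ?thesis
      using that by simp
  qed
  \<comment> \<open>A cutoff with value 1 up to radius \<open>r / 2\<close> and value 0 at radius
    \<open>r\<close>.\<close>
  define s where "s x = min 1 (2 - 2 * dist x0 x / r)" for x
  define G where "G = (\<lambda>(t::real, x). x + (t * s x) *\<^sub>R (P x - x))"
  have cb: "cball x0 r \<subseteq> ball (\<phi> p) R"
    using r by (auto simp: x0_def)
  then have sub: "cball x0 r \<subseteq> \<phi> ` U"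
    using R by blast
  have s01: "0 \<le> s x" "s x \<le> 1" if "x \<in> cball x0 r" for x
    using that r by (auto simp: s_def field_simps)
  define h where "h = (\<lambda>q. if q \<in> U \<and> \<phi> q \<in> cball x0 r then inv_into U \<phi> (G (1, \<phi> q)) else q)"
  have "homotopic_with (\<lambda>_. True) M M id h"
    unfolding h_def
  proof (rule chart_extension_homotopic_id[OF M chart sub])
    show "continuous_on ({0..1} \<times> cball x0 r) G"
      unfolding G_def case_prod_unfold s_def using r(1) by (intro continuous_intros P.continuous_on) auto
    show "G (t, x) \<in> cball x0 r" if tx: "t \<in> {0..1}" "x \<in> cball x0 r" for t x
    proof -
      have "t * s x \<le> 1" "0 \<le> t * s x"
        using tx s01[OF tx(2)] by (auto intro: mult_le_one)
      then have "(1 - t * s x) *\<^sub>R x + (t * s x) *\<^sub>R P x \<in> cball x0 r"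
        using tx(2) Pc[OF tx(2)] by (intro convexD[OF convex_cball]) auto
      then show ?thesis
        by (simp add: G_def algebra_simps)
    qed
    show "G (t, x) = x" if "t \<in> {0..1}" "dist x0 x = r" for t x
      using that r by (simp add: G_def s_def)
  qed (auto simp: G_def)
  moreover have "h q = q" if q: "q \<in> S" for q
  proof (cases "q \<in> U \<and> \<phi> q \<in> cball x0 r")
    case True
    then have "\<phi> q \<in> L"
      using S[of q] q cb by blast
    with True show ?thesis
      using ch(4) by (simp add: h_def G_def Pid)
  qed (auto simp: h_def)
  moreover have "h q \<in> S" if q: "q \<in> U" "\<phi> q \<in> ball x0 (r / 2)" for q
  proof -
    have qc: "\<phi> q \<in> cball x0 r"
      using q r by simp
    have "s (\<phi> q) = 1"
      using q r by (simp add: s_def field_simps)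
    then have hq: "h q = inv_into U \<phi> (P (\<phi> q))"
      using q qc by (simp add: h_def G_def)
    have "P (\<phi> q) \<in> \<phi> ` U" "P (\<phi> q) \<in> ball (\<phi> p) R"
      using Pc[OF qc] sub cb by blast+
    then show ?thesis
      using S[of "h q"] PL inv_into_into[of "P (\<phi> q)" \<phi> U] f_inv_into_f[of "P (\<phi> q)" \<phi> U]
      by (simp add: hq)
  qed
  moreover have "openin M {q \<in> U. \<phi> q \<in> ball x0 (r / 2)}"
    by (rule openin_chart_preimage[OF chart]) simp
  moreover have "p \<in> {q \<in> U. \<phi> q \<in> ball x0 (r / 2)}"
    using p r by (simp add: x0_def)
  ultimately show ?thesis
    by (intro exI[of _ h] exI[of _ "{q \<in> U. \<phi> q \<in> ball x0 (r / 2)}"]) auto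
qed

section \<open>Pushes near critical and non-critical points\<close>

lemma smooth_manifoldD:
  assumes "smooth_manifold M A"
  shows "Hausdorff_space M" "\<And>a. a \<in> A \<Longrightarrow> is_chart M a" "\<And>q. q \<in> topspace M \<Longrightarrow> \<exists>U \<phi>. (U, \<phi>) \<in> A \<and> q \<in> U"
proof -
  show "Hausdorff_space M" "\<And>a. a \<in> A \<Longrightarrow> is_chart M a"
    using assms unfolding smooth_manifold_def smooth_atlas_def by blast+
  have "\<Union>(fst ` A) = topspace M"
    using assms unfolding smooth_manifold_def smooth_atlas_def by blast
  then have "\<exists>a\<in>A. q \<in> fst a" if "q \<in> topspace M" for q
    using that by blast
  then show "\<exists>U \<phi>. (U, \<phi>) \<in> A \<and> q \<in> U" if "q \<in> topspace M" for q
    using that by (metis prod.collapse)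
qed

lemma smooth_function_Ck_on:
  assumes "smooth_function A \<Phi>" "(U, \<phi>) \<in> A"
  shows "Ck_on k (\<phi> ` U) (\<Phi> \<circ> inv_into U \<phi>)"
  using assms by (auto simp: smooth_function_def smooth_on_def)

lemma smooth_function_continuous_map:
  fixes A :: "('m set \<times> ('m \<Rightarrow> 'e::{real_inner,heine_borel})) set"
  assumes M: "smooth_manifold M A" and \<Phi>: "smooth_function A \<Phi>"
  shows "continuous_map M euclideanreal \<Phi>"
  unfolding continuous_map_def
proof (intro conjI allI impI)
  fix B :: "real set" assume "openin euclideanreal B"
  then have B: "open B"
    by simp
  show "openin M {q \<in> topspace M. \<Phi> q \<in> B}"
  proof (subst openin_subopen, intro ballI)
    fix q assume q: "q \<in> {q \<in> topspace M. \<Phi> q \<in> B}"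
    then obtain U \<phi> where U: "(U, \<phi>) \<in> A" "q \<in> U"
      using smooth_manifoldD(3)[OF M] by blast
    have chart: "is_chart M (U, \<phi>)"
      using smooth_manifoldD(2)[OF M] U by blast
    note ch = is_chartD[OF chart]
    have "continuous_on (\<phi> ` U) (\<Phi> \<circ> inv_into U \<phi>)"
      using smooth_function_Ck_on[OF \<Phi> U(1), of 0] by simp
    then have "open (\<phi> ` U \<inter> (\<Phi> \<circ> inv_into U \<phi>) -` B)"
      using ch(3) B by (rule continuous_open_preimage)
    then have "openin M {q \<in> U. \<phi> q \<in> \<phi> ` U \<inter> (\<Phi> \<circ> inv_into U \<phi>) -` B}"
      by (rule openin_chart_preimage[OF chart])
    then show "\<exists>T. openin M T \<and> q \<in> T \<and> T \<subseteq> {q \<in> topspace M. \<Phi> q \<in> B}"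
      using q U ch(2,4)
      by (intro exI[of _ "{q \<in> U. \<phi> q \<in> \<phi> ` U \<inter> (\<Phi> \<circ> inv_into U \<phi>) -` B}"])
        (auto dest: inj_onD[OF ch(4)])
  qed
qed auto

lemma noncritical_point:
  assumes "q \<in> topspace M" "q \<notin> critical_points M A \<Phi>"
  obtains U \<phi> where "(U, \<phi>) \<in> A" "q \<in> U" "frechet_derivative (\<Phi> \<circ> inv_into U \<phi>) (at (\<phi> q)) \<noteq> (\<lambda>v. 0)"
  using assms unfolding critical_points_def by blast

lemma critical_pointD:
  assumes "q \<in> critical_points M A \<Phi>" "(U, \<phi>) \<in> A" "q \<in> U"
  shows "frechet_derivative (\<Phi> \<circ> inv_into U \<phi>) (at (\<phi> q)) = (\<lambda>v. 0)"
  using assms unfolding critical_points_def by blast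

text \<open>Since \<open>critical_points\<close> quantifies over all charts, one chart with nonzero
  derivative certifies a noncritical point; the same chart and direction certify all nearby points
  by continuity.\<close>

lemma closedin_critical_points:
  fixes A :: "('m set \<times> ('m \<Rightarrow> 'e::{real_inner,heine_borel})) set"
  assumes M: "smooth_manifold M A" and \<Phi>: "smooth_function A \<Phi>"
  shows "closedin M (critical_points M A \<Phi>)"
  unfolding closedin_def
proof
  show "critical_points M A \<Phi> \<subseteq> topspace M"
    by (auto simp: critical_points_def)
  show "openin M (topspace M - critical_points M A \<Phi>)"
  proof (subst openin_subopen, intro ballI)
    fix q assume "q \<in> topspace M - critical_points M A \<Phi>"
    then obtain U \<phi> where U: "(U, \<phi>) \<in> A" "q \<in> U"
      and nz: "frechet_derivative (\<Phi> \<circ> inv_into U \<phi>) (at (\<phi> q)) \<noteq> (\<lambda>v. 0)"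
      using noncritical_point by (metis DiffE)
    then obtain v where v: "frechet_derivative (\<Phi> \<circ> inv_into U \<phi>) (at (\<phi> q)) v \<noteq> 0"
      by auto
    have chart: "is_chart M (U, \<phi>)"
      using smooth_manifoldD(2)[OF M] U by blast
    note ch = is_chartD[OF chart]
    define B where "B = \<phi> ` U \<inter> (\<lambda>x. frechet_derivative (\<Phi> \<circ> inv_into U \<phi>) (at x) v) -` (- {0})"
    have "continuous_on (\<phi> ` U) (\<lambda>x. frechet_derivative (\<Phi> \<circ> inv_into U \<phi>) (at x) v)"
      using smooth_function_Ck_on[OF \<Phi> U(1), of 1] by simp
    then have "open B"
      unfolding B_def using ch(3) by (rule continuous_open_preimage) (simp add: open_Compl)
    then have op: "openin M {q \<in> U. \<phi> q \<in> B}"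
      by (rule openin_chart_preimage[OF chart])
    have "{q \<in> U. \<phi> q \<in> B} \<subseteq> topspace M - critical_points M A \<Phi>"
    proof
      fix y assume y: "y \<in> {q \<in> U. \<phi> q \<in> B}"
      then have "frechet_derivative (\<Phi> \<circ> inv_into U \<phi>) (at (\<phi> y)) v \<noteq> 0"
        by (simp add: B_def)
      then have "y \<notin> critical_points M A \<Phi>"
        using critical_pointD[of y M A \<Phi> U \<phi>] U y by auto
      then show "y \<in> topspace M - critical_points M A \<Phi>"
        using y ch(2) by auto
    qed
    then show "\<exists>T. openin M T \<and> q \<in> T \<and> T \<subseteq> topspace M - critical_points M A \<Phi>"
      using op U v by (intro exI[of _ "{q \<in> U. \<phi> q \<in> B}"]) (simp add: B_def)
  qed
qed

lemma noncritical_push_exists: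
  assumes M: "smooth_manifold M A" and \<Phi>: "smooth_function A \<Phi>"
    and p: "p \<in> topspace M" "p \<notin> critical_points M A \<Phi>"
  shows "\<exists>h V. homotopic_with (\<lambda>_. True) M M id h \<and> openin M V \<and> p \<in> V \<and>
    (\<forall>q. h q = q \<or> \<Phi> (h q) < \<Phi> q) \<and> (\<forall>q\<in>V. \<Phi> (h q) < \<Phi> q)"
proof -
  obtain U \<phi> where U: "(U, \<phi>) \<in> A" "p \<in> U"
    and nz: "frechet_derivative (\<Phi> \<circ> inv_into U \<phi>) (at (\<phi> p)) \<noteq> (\<lambda>v. 0)"
    using noncritical_point[OF p] by metis
  show ?thesis
    using smooth_manifoldD(1,2)[OF M] U nz smooth_function_Ck_on[OF \<Phi> U(1)]
    by (intro descending_push_exists[of M U \<phi>]) auto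
qed

text \<open>The push fixes every critical point of the level, not only those in the component
  \<open>S\<close> through \<open>p\<close>; this is what makes pushes at different points
  composable. It rests on nondegeneracy, which keeps other components, of whatever dimension, from
  accumulating at \<open>p\<close>.\<close>

lemma critical_push_exists:
  fixes A :: "('m set \<times> ('m \<Rightarrow> 'e::{real_inner,heine_borel})) set"
  assumes M: "smooth_manifold M A" and mb: "morse_bott M A \<Phi>"
    and p: "p \<in> critical_points M A \<Phi>"
  shows "\<exists>h V. homotopic_with (\<lambda>_. True) M M id h \<and> openin M V \<and> p \<in> V \<and>
    (\<forall>q \<in> {q \<in> critical_points M A \<Phi>. \<Phi> q = \<Phi> p}. h q = q) \<and>
    h ` V \<subseteq> {q \<in> critical_points M A \<Phi>. \<Phi> q = \<Phi> p}"
proof -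
  have \<Phi>: "smooth_function A \<Phi>"
    using mb by (simp add: morse_bott_def)
  obtain S where S: "p \<in> S" "S \<subseteq> critical_points M A \<Phi>" "transversally_nondegenerate A \<Phi> S p"
    and "\<exists>d. smooth_submanifold M A d S"
    using mb p unfolding morse_bott_def by blast
  then obtain U \<phi> L where U: "p \<in> U" and slice: "slice_chart A S U \<phi> L"
    unfolding smooth_submanifold_def by blast
  then have UA: "(U, \<phi>) \<in> A" and L: "subspace L" and SL: "\<phi> ` (U \<inter> S) = \<phi> ` U \<inter> L"
    by (auto simp: slice_chart_def)
  have chart: "is_chart M (U, \<phi>)"
    using smooth_manifoldD(2)[OF M] UA by blast
  note ch = is_chartD[OF chart]
  define F where "F = \<Phi> \<circ> inv_into U \<phi>"
  have pL: "\<phi> p \<in> L"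
    using SL S U by blast
  have SLiff: "q \<in> S \<longleftrightarrow> \<phi> q \<in> L" if q: "q \<in> U" for q
  proof
    assume "\<phi> q \<in> L"
    then have "\<phi> q \<in> \<phi> ` (U \<inter> S)"
      using SL q by blast
    then show "q \<in> S"
      using ch(4) q by (auto dest: inj_onD)
  qed (use SL q in blast)
  have crit0: "frechet_derivative F (at x) = (\<lambda>v. 0)" if "x \<in> \<phi> ` U \<inter> L" for x
    using that S(2) SLiff unfolding F_def by (auto intro!: critical_pointD[OF _ UA])
  have "\<exists>r>0. ball (\<phi> p) r \<subseteq> \<phi> ` U \<and> (\<forall>x\<in>ball (\<phi> p) r. frechet_derivative F (at x) = (\<lambda>v. 0) \<longrightarrow> x \<in> L)"
  proof (rule nondegenerate_critical_set_local[OF ch(3) _ L pL _ crit0])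
    show "\<phi> p \<in> \<phi> ` U"
      using U by simp
    show "Ck_on 2 (\<phi> ` U) F"
      unfolding F_def by (rule smooth_function_Ck_on[OF \<Phi> UA])
    show "v \<in> L" if "\<And>w. frechet_derivative (\<lambda>x. frechet_derivative F (at x) v) (at (\<phi> p)) w = 0" for v
    proof -
      have "\<forall>w. hessian \<Phi> U \<phi> p v w = 0"
        using that by (simp add: hessian_def F_def)
      then show ?thesis
        using S(3) U slice unfolding transversally_nondegenerate_def by blast
    qed
  next
    fix r assume "0 < r" "ball (\<phi> p) r \<subseteq> \<phi> ` U"
      "\<And>x. x \<in> ball (\<phi> p) r \<Longrightarrow> frechet_derivative F (at x) = (\<lambda>v. 0) \<Longrightarrow> x \<in> L"
    then show "\<exists>r>0. ball (\<phi> p) r \<subseteq> \<phi> ` U \<and> (\<forall>x\<in>ball (\<phi> p) r. frechet_derivative F (at x) = (\<lambda>v. 0) \<longrightarrow> x \<in> L)"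
      by (intro exI[of _ r]) simp
  qed
  then obtain r where r: "0 < r" "ball (\<phi> p) r \<subseteq> \<phi> ` U"
    and rL: "\<And>x. x \<in> ball (\<phi> p) r \<Longrightarrow> frechet_derivative F (at x) = (\<lambda>v. 0) \<Longrightarrow> x \<in> L"
    by blast
  show ?thesis
  proof (rule slice_push_exists[OF smooth_manifoldD(1)[OF M] chart U L pL r])
    fix q assume q: "q \<in> U" "\<phi> q \<in> ball (\<phi> p) r"
    show "q \<in> {q \<in> critical_points M A \<Phi>. \<Phi> q = \<Phi> p} \<longleftrightarrow> \<phi> q \<in> L"
    proof
      assume "q \<in> {q \<in> critical_points M A \<Phi>. \<Phi> q = \<Phi> p}"
      then show "\<phi> q \<in> L"
        using rL[OF q(2)] critical_pointD[of q M A \<Phi>, OF _ UA q(1)] by (simp add: F_def)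
    next
      assume qL: "\<phi> q \<in> L"
      \<comment> \<open>Ball and subspace are both convex, so the segment from
        \<open>\<phi> p\<close> to \<open>\<phi> q\<close> consists of critical points and \<Phi> is
        constant along it. Hence \<open>q\<close> lies on the level of \<open>p\<close>.\<close>
      have seg: "\<phi> p + a *\<^sub>R (\<phi> q - \<phi> p) \<in> \<phi> ` U \<inter> L" if a: "0 \<le> a" "a \<le> 1" for a
      proof -
        have "(1 - a) *\<^sub>R \<phi> p + a *\<^sub>R \<phi> q \<in> ball (\<phi> p) r"
          using a q r by (intro convexD[OF convex_ball]) auto
        then have "\<phi> p + a *\<^sub>R (\<phi> q - \<phi> p) \<in> \<phi> ` U"
          using r(2) by (auto simp: algebra_simps)
        then show ?thesis
          using qL pL L by (simp add: subspace_add subspace_diff subspace_scale)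
      qed
      have diff: "F differentiable (at (\<phi> p + a *\<^sub>R (\<phi> q - \<phi> p)))" if "0 \<le> a" "a \<le> 1" for a
        using smooth_function_Ck_on[OF \<Phi> UA, of 1] seg[OF that]
        unfolding F_def One_nat_def Ck_on.simps by blast
      obtain a where "0 < a" "a < 1"
        "F (\<phi> p + 1 *\<^sub>R (\<phi> q - \<phi> p)) - F (\<phi> p) =
           1 * frechet_derivative F (at (\<phi> p + a *\<^sub>R (\<phi> q - \<phi> p))) (\<phi> q - \<phi> p)"
        by (rule mvt_line[OF zero_less_one diff])
      then have "F (\<phi> q) = F (\<phi> p)"
        using crit0[OF seg[of a]] by simp
      then have "\<Phi> q = \<Phi> p"
        using q U ch(4) by (simp add: F_def)
      then show "q \<in> {q \<in> critical_points M A \<Phi>. \<Phi> q = \<Phi> p}"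
        using qL SLiff[OF q(1)] S(2) by auto
    qed
  qed
qed

section \<open>Covers of sublevel sets\<close>

text \<open>\<open>n\<close> counts the sets themselves, one more than the index used by the
  homotopic distance, so that counts add under unions and 0 stands for the empty set. The members
  are open in M rather than in \<open>B\<close>, so covers of different subsets can be
  merged.\<close>

definition homotopic_cover :: "'a topology \<Rightarrow> 'b topology \<Rightarrow> ('a \<Rightarrow> 'b) \<Rightarrow> ('a \<Rightarrow> 'b) \<Rightarrow> 'a set \<Rightarrow> nat \<Rightarrow> bool" where
  "homotopic_cover M Y f g B n \<longleftrightarrow> (\<exists>U :: nat \<Rightarrow> 'a set.
     (\<forall>j<n. openin M (U j) \<and> homotopic_with (\<lambda>_. True) (subtopology M (U j)) Y f g) \<and> B \<subseteq> (\<Union>j<n. U j))"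

lemma homotopic_cover_subset:
  "homotopic_cover M Y f g B n \<Longrightarrow> C \<subseteq> B \<Longrightarrow> homotopic_cover M Y f g C n"
  unfolding homotopic_cover_def by (meson subset_trans)

lemma homotopic_cover_Un:
  assumes "homotopic_cover M Y f g B m" "homotopic_cover M Y f g C n"
  shows "homotopic_cover M Y f g (B \<union> C) (m + n)"
proof -
  obtain U V :: "nat \<Rightarrow> _" where
    U: "\<forall>j<m. openin M (U j) \<and> homotopic_with (\<lambda>_. True) (subtopology M (U j)) Y f g" "B \<subseteq> (\<Union>j<m. U j)"
    and V: "\<forall>j<n. openin M (V j) \<and> homotopic_with (\<lambda>_. True) (subtopology M (V j)) Y f g" "C \<subseteq> (\<Union>j<n. V j)"
    using assms unfolding homotopic_cover_def by (elim exE conjE) (rule that)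
  define W where "W j = (if j < m then U j else V (j - m))" for j
  have "B \<subseteq> (\<Union>j<m+n. W j)"
  proof
    fix x assume "x \<in> B"
    then obtain j where "j < m" "x \<in> U j"
      using U(2) by auto
    then show "x \<in> (\<Union>j<m+n. W j)"
      by (intro UN_I[of j]) (auto simp: W_def)
  qed
  moreover have "C \<subseteq> (\<Union>j<m+n. W j)"
  proof
    fix x assume "x \<in> C"
    then obtain j where "j < n" "x \<in> V j"
      using V(2) by auto
    then show "x \<in> (\<Union>j<m+n. W j)"
      by (intro UN_I[of "m + j"]) (auto simp: W_def)
  qed
  moreover have "openin M (W j) \<and> homotopic_with (\<lambda>_. True) (subtopology M (W j)) Y f g" if "j < m + n" for j
    using that U(1) V(1) by (auto simp: W_def)
  ultimately show ?thesis
    unfolding homotopic_cover_def by (intro exI[of _ W]) simp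
qed

lemma homotopic_cover_empty:
  assumes "continuous_map M Y f"
  shows "homotopic_cover M Y f g {} n"
proof -
  have "homotopic_with (\<lambda>_. True) (subtopology M {}) Y f g"
    by (rule homotopic_with_equal) (use assms in \<open>simp_all add: continuous_map_from_subtopology\<close>)
  then show ?thesis
    unfolding homotopic_cover_def by (intro exI[of _ "\<lambda>_. {}"]) simp
qed

lemma homotopic_cover_mono:
  assumes "continuous_map M Y f" "homotopic_cover M Y f g B m" "m \<le> n"
  shows "homotopic_cover M Y f g B n"
  using homotopic_cover_Un[OF assms(2) homotopic_cover_empty[OF assms(1), where n = "n - m"]] assms(3) by simp

text \<open>The preimages under \<open>h\<close> of the sets covering \<open>B\<close> do the job.
  This takes the place of a deformation of sublevel sets: it suffices that the end map
  \<open>h\<close> carries \<open>C\<close> into \<open>B\<close>.\<close>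

lemma homotopic_cover_pullback:
  assumes h: "homotopic_with (\<lambda>_. True) M M id h"
    and f: "continuous_map M Y f" and g: "continuous_map M Y g"
    and B: "homotopic_cover M Y f g B n"
    and C: "C \<subseteq> topspace M" "h ` C \<subseteq> B"
  shows "homotopic_cover M Y f g C n"
proof -
  obtain U :: "nat \<Rightarrow> _" where
    U: "\<forall>j<n. openin M (U j) \<and> homotopic_with (\<lambda>_. True) (subtopology M (U j)) Y f g" "B \<subseteq> (\<Union>j<n. U j)"
    using B unfolding homotopic_cover_def by (elim exE conjE) (rule that)
  define W where "W j = {q \<in> topspace M. h q \<in> U j}" for j
  have "openin M (W j) \<and> homotopic_with (\<lambda>_. True) (subtopology M (W j)) Y f g" if "j < n" for j
  proof
    show "openin M (W j)"
      unfolding W_def using U(1) that by (intro openin_continuous_map_preimage[OF homotopic_id_continuous[OF h]]) simp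
    show "homotopic_with (\<lambda>_. True) (subtopology M (W j)) Y f g"
      by (rule homotopic_on_pullback[OF h f g, of "U j"]) (use U(1) that in \<open>auto simp: W_def\<close>)
  qed
  moreover have "C \<subseteq> (\<Union>j<n. W j)"
    using C U(2) by (fastforce simp: W_def)
  ultimately show ?thesis
    unfolding homotopic_cover_def by (intro exI[of _ W]) simp
qed

lemma homotopic_distance_le:
  assumes "homotopic_cover M Y f g (topspace M) (Suc n)"
  shows "homotopic_distance M Y f g \<le> enat n"
proof -
  obtain U :: "nat \<Rightarrow> _" where
    U: "\<forall>j<Suc n. openin M (U j) \<and> homotopic_with (\<lambda>_. True) (subtopology M (U j)) Y f g"
      "topspace M \<subseteq> (\<Union>j<Suc n. U j)"
    using assms unfolding homotopic_cover_def by (elim exE conjE) (rule that)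
  have "(\<Union>j\<le>n. U j) = topspace M"
    using U openin_subset unfolding lessThan_Suc_atMost by (fastforce simp: less_Suc_eq_le)
  then show ?thesis
    unfolding homotopic_distance_def using U(1)
    by (intro Inf_lower) (auto simp: less_Suc_eq_le intro!: exI[of _ U])
qed

lemma homotopic_distance_attained:
  assumes "homotopic_distance X Y f g = enat n"
  obtains U :: "nat \<Rightarrow> 'a set" where "\<forall>j\<le>n. openin X (U j)" "(\<Union>j\<le>n. U j) = topspace X"
     "\<forall>j\<le>n. homotopic_with (\<lambda>_. True) (subtopology X (U j)) Y f g"
proof -
  define E where "E = {enat n | n. \<exists>U :: nat \<Rightarrow> 'a set.
     (\<forall>j\<le>n. openin X (U j)) \<and> (\<Union>j\<le>n. U j) = topspace X \<and>
     (\<forall>j\<le>n. homotopic_with (\<lambda>_. True) (subtopology X (U j)) Y f g)}"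
  have "Inf E = enat n"
    using assms by (simp add: homotopic_distance_def E_def)
  \<comment> \<open>The infimum of the empty set is infinite, so a finite value forces a nonempty
    set, whose infimum is attained by well-ordering.\<close>
  moreover from this have "E \<noteq> {}"
    by (auto simp: Inf_enat_def)
  ultimately have "enat n \<in> E"
    by (metis Inf_enat_def LeastI_ex ex_in_conv)
  then show thesis
    using that unfolding E_def by blast
qed

text \<open>The optimal cover of \<open>\<Sigma>\<close> is open in \<open>\<Sigma>\<close> only.
  Since \<open>h\<close> sends \<open>N\<close> into \<open>\<Sigma>\<close>, the preimage of
  \<open>T \<inter> \<Sigma>\<close> within \<open>N\<close> equals that of the open set
  \<open>T\<close>, and is therefore open in M.\<close>

lemma homotopic_cover_neighbourhood:
  assumes h: "homotopic_with (\<lambda>_. True) M M id h"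
    and f: "continuous_map M Y f" and g: "continuous_map M Y g"
    and N: "openin M N" "h ` N \<subseteq> \<Sigma>" and \<Sigma>: "\<Sigma> \<subseteq> topspace M"
    and dist: "subspace_distance M \<Sigma> Y f g = enat n"
  shows "homotopic_cover M Y f g N (Suc n)"
proof -
  obtain U :: "nat \<Rightarrow> _" where U: "\<forall>j\<le>n. openin (subtopology M \<Sigma>) (U j)"
    and Un: "(\<Union>j\<le>n. U j) = topspace (subtopology M \<Sigma>)"
    and hom: "\<forall>j\<le>n. homotopic_with (\<lambda>_. True) (subtopology (subtopology M \<Sigma>) (U j)) Y f g"
    using dist unfolding subspace_distance_def by (rule homotopic_distance_attained)
  define W where "W j = {q \<in> N. h q \<in> U j}" for j
  have NM: "N \<subseteq> topspace M"
    using N by (simp add: openin_subset)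
  have "openin M (W j) \<and> homotopic_with (\<lambda>_. True) (subtopology M (W j)) Y f g" if "j < Suc n" for j
  proof
    obtain T where T: "openin M T" "U j = T \<inter> \<Sigma>"
      using U \<open>j < Suc n\<close> by (auto simp: less_Suc_eq_le openin_subtopology)
    have "W j = {q \<in> N. h q \<in> T}"
      using N T by (auto simp: W_def)
    then show "openin M (W j)"
      using openin_continuous_map_preimage_gen[OF homotopic_id_continuous[OF h] N(1) T(1)] by simp
    have "subtopology (subtopology M \<Sigma>) (U j) = subtopology M (U j)"
      using T by (simp add: subtopology_subtopology Int_absorb1)
    then have "homotopic_with (\<lambda>_. True) (subtopology M (U j)) Y f g"
      using hom \<open>j < Suc n\<close> by (metis less_Suc_eq_le)
    then show "homotopic_with (\<lambda>_. True) (subtopology M (W j)) Y f g"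
      by (rule homotopic_on_pullback[OF h f g]) (auto simp: W_def)
  qed
  moreover have "N \<subseteq> (\<Union>j<Suc n. W j)"
  proof
    fix q assume q: "q \<in> N"
    then have "h q \<in> (\<Union>j\<le>n. U j)"
      using N \<Sigma> Un by auto
    then show "q \<in> (\<Union>j<Suc n. W j)"
      using q by (auto simp: W_def less_Suc_eq_le)
  qed
  ultimately show ?thesis
    unfolding homotopic_cover_def by (intro exI[of _ W]) simp
qed

text \<open>The alternative \<open>h q = q\<close>, rather than just \<open>\<Phi> (h q) \<le> \<Phi> q\<close>, is what lets strict descent survive
  composition: a point not lowered by the earlier pushes has not left the domain of the next one.\<close>

lemma compactin_descending_push:
  assumes K: "compactin M K"
    and loc: "\<And>p. p \<in> K \<Longrightarrow> \<exists>h V. homotopic_with (\<lambda>_. True) M M id h \<and> openin M V \<and> p \<in> V \<and>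
      (\<forall>q. h q = q \<or> \<Phi> (h q) < \<Phi> q) \<and> (\<forall>q\<in>V. \<Phi> (h q) < (\<Phi> q :: real))"
  shows "\<exists>h. homotopic_with (\<lambda>_. True) M M id h \<and> (\<forall>q. h q = q \<or> \<Phi> (h q) < \<Phi> q) \<and> (\<forall>q\<in>K. \<Phi> (h q) < \<Phi> q)"
proof -
  define P where "P V h \<longleftrightarrow> homotopic_with (\<lambda>_. True) M M id h \<and>
      (\<forall>q. h q = q \<or> \<Phi> (h q) < \<Phi> q) \<and> (\<forall>q\<in>V. \<Phi> (h q) < \<Phi> q)" for V h
  define \<V> where "\<V> = {V. openin M V \<and> (\<exists>h. P V h)}"
  have "\<exists>h V. openin M V \<and> p \<in> V \<and> P V h" if "p \<in> K" for p
    using loc[OF that] by (elim exE conjE) (auto simp: P_def)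
  then have "K \<subseteq> \<Union>\<V>"
    unfolding \<V>_def by blast
  moreover have "\<And>V. V \<in> \<V> \<Longrightarrow> openin M V"
    by (simp add: \<V>_def)
  ultimately obtain \<F> where \<F>: "finite \<F>" "\<F> \<subseteq> \<V>" "K \<subseteq> \<Union>\<F>"
    using K unfolding compactin_def by metis
  from \<F>(1,2) have "\<exists>h. P (\<Union>\<F>) h"
  proof (induction \<F> rule: finite_induct)
    case empty
    have "P (\<Union>{}) id"
      by (simp add: P_def)
    then show ?case
      by blast
  next
    case (insert V \<F>)
    then obtain h k where h: "P (\<Union>\<F>) h" and k: "P V k"
      by (auto simp: \<V>_def)
    have "P (\<Union>(insert V \<F>)) (k \<circ> h)"
      unfolding P_def
    proof (intro conjI allI ballI)
      have hk: "h q = q \<or> \<Phi> (h q) < \<Phi> q" "k q = q \<or> \<Phi> (k q) < \<Phi> q" for q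
        using h k by (auto simp: P_def)
      show "homotopic_with (\<lambda>_. True) M M id (k \<circ> h)"
        using h k by (auto simp: P_def intro: homotopic_id_compose)
      show "(k \<circ> h) q = q \<or> \<Phi> ((k \<circ> h) q) < \<Phi> q" for q
        using hk(1)[of q] hk(2)[of "h q"] by auto
      show "\<Phi> ((k \<circ> h) q) < \<Phi> q" if q: "q \<in> \<Union>(insert V \<F>)" for q
      proof (cases "\<Phi> (h q) < \<Phi> q")
        case True
        then show ?thesis
          using hk(2)[of "h q"] by auto
      next
        case False
        then have "h q = q"
          using hk(1)[of q] by simp
        moreover have "q \<notin> \<Union>\<F>"
          using False h unfolding P_def by blast
        ultimately show ?thesis
          using q k by (auto simp: P_def)
      qed
    qed
    then show ?case
      by blast
  qed
  then obtain h where "P (\<Union>\<F>) h"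
    by blast
  then show ?thesis
    using \<F>(3) unfolding P_def by (intro exI[of _ h]) auto
qed

text \<open>As every push fixes \<open>\<Sigma>\<close> pointwise, a point that has reached
  \<open>\<Sigma>\<close> stays there under all later pushes, so finitely many local pushes can be
  applied in succession.\<close>

lemma compactin_push_into:
  assumes \<Sigma>: "compactin M \<Sigma>"
    and loc: "\<And>p. p \<in> \<Sigma> \<Longrightarrow> \<exists>h V. homotopic_with (\<lambda>_. True) M M id h \<and> openin M V \<and> p \<in> V \<and>
      (\<forall>q\<in>\<Sigma>. h q = q) \<and> h ` V \<subseteq> \<Sigma>"
  shows "\<exists>h N. homotopic_with (\<lambda>_. True) M M id h \<and> openin M N \<and> \<Sigma> \<subseteq> N \<and> h ` N \<subseteq> \<Sigma>"
proof -
  define P where "P V h \<longleftrightarrow> homotopic_with (\<lambda>_. True) M M id h \<and> openin M V \<and> (\<forall>q\<in>\<Sigma>. h q = q) \<and> h ` V \<subseteq> \<Sigma>" for V h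
  define \<V> where "\<V> = {V. \<exists>h. P V h}"
  have "\<Sigma> \<subseteq> \<Union>\<V>"
    using loc unfolding \<V>_def P_def by blast
  moreover have "\<And>V. V \<in> \<V> \<Longrightarrow> openin M V"
    by (auto simp: \<V>_def P_def)
  ultimately obtain \<F> where \<F>: "finite \<F>" "\<F> \<subseteq> \<V>" "\<Sigma> \<subseteq> \<Union>\<F>"
    using \<Sigma> unfolding compactin_def by metis
  \<comment> \<open>The invariant speaks of \<open>\<Sigma> \<inter> \<Union>\<F>\<close> only:
    earlier pushes may carry points of a later \<open>V\<close> outside \<open>\<Sigma>\<close> away
    from \<open>V\<close>.\<close>
  from \<F>(1,2) have "\<exists>h N. P N h \<and> \<Sigma> \<inter> \<Union>\<F> \<subseteq> N"
  proof (induction \<F> rule: finite_induct)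
    case empty
    have "P {} id"
      by (simp add: P_def)
    then show ?case
      by blast
  next
    case (insert V \<F>)
    then obtain h N k where h: "P N h" "\<Sigma> \<inter> \<Union>\<F> \<subseteq> N" and k: "P V k"
      by (auto simp: \<V>_def)
    have hM: "continuous_map M M h"
      using h by (auto simp: P_def intro: homotopic_id_continuous)
    \<comment> \<open>This preimage replaces \<open>V\<close> itself. It contains
      \<open>\<Sigma> \<inter> V\<close> because \<open>h\<close> is the identity on
      \<open>\<Sigma>\<close>, and \<open>k\<close> after \<open>h\<close> sends it into
      \<open>\<Sigma>\<close>.\<close>
    have "openin M {q \<in> topspace M. h q \<in> V}"
      using k by (intro openin_continuous_map_preimage[OF hM]) (simp add: P_def)
    then have "P (N \<union> {q \<in> topspace M. h q \<in> V}) (k \<circ> h)"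
      using h k by (auto simp: P_def intro: homotopic_id_compose)
    moreover have "\<Sigma> \<inter> \<Union>(insert V \<F>) \<subseteq> N \<union> {q \<in> topspace M. h q \<in> V}"
      using h \<Sigma>[THEN compactin_subset_topspace] by (auto simp: P_def)
    ultimately show ?case
      by blast
  qed
  then obtain h N where hN: "P N h" "\<Sigma> \<inter> \<Union>\<F> \<subseteq> N"
    by (elim exE conjE) (rule that)
  have "\<Sigma> \<subseteq> N"
    using hN(2) \<F>(3) by blast
  with hN(1) show ?thesis
    by (intro exI[of _ h] exI[of _ N]) (simp add: P_def)
qed

section \<open>Crossing one level and sweeping through all of them\<close>

text \<open>\<open>h\<close> and hence \<open>\<epsilon>\<close> are chosen before \<open>n\<close>.
  This uniformity matters because the number of sets available at level
  \<open>c - \<epsilon>\<close> is itself known only once \<open>\<epsilon>\<close> is. Regular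
  levels are the case of empty \<open>N\<close> and \<open>m = 0\<close>.\<close>

lemma cross_level:
  fixes \<Phi> :: "'m \<Rightarrow> real"
  assumes M: "compact_space M" and \<Phi>: "continuous_map M euclideanreal \<Phi>"
    and f: "continuous_map M Y f" and g: "continuous_map M Y g"
    and loc: "\<And>p. p \<in> topspace M \<Longrightarrow> p \<notin> C \<Longrightarrow>
      \<exists>h V. homotopic_with (\<lambda>_. True) M M id h \<and> openin M V \<and> p \<in> V \<and>
        (\<forall>q. h q = q \<or> \<Phi> (h q) < \<Phi> q) \<and> (\<forall>q\<in>V. \<Phi> (h q) < \<Phi> q)"
    and e: "0 < e" and N: "openin M N" "homotopic_cover M Y f g N m"
    and CN: "\<And>p. p \<in> C \<Longrightarrow> \<bar>\<Phi> p - c\<bar> \<le> e \<Longrightarrow> p \<in> N"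
  shows "\<exists>\<epsilon>>0. \<forall>n. homotopic_cover M Y f g {q \<in> topspace M. \<Phi> q \<le> c - \<epsilon>} n \<longrightarrow>
           homotopic_cover M Y f g {q \<in> topspace M. \<Phi> q \<le> c + \<epsilon>} (n + m)"
proof -
  define K where "K = {q \<in> topspace M. \<Phi> q \<in> {c - e..c + e}} - N"
  have "closedin M K"
    unfolding K_def by (intro closedin_diff closedin_continuous_map_preimage[OF \<Phi>] N) simp
  then have K: "compactin M K"
    using M by (rule closedin_compact_space[rotated])
  have "\<exists>h. homotopic_with (\<lambda>_. True) M M id h \<and> (\<forall>q. h q = q \<or> \<Phi> (h q) < \<Phi> q) \<and> (\<forall>q\<in>K. \<Phi> (h q) < \<Phi> q)"
  proof (rule compactin_descending_push[OF K loc])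
    show "p \<in> topspace M" if "p \<in> K" for p
      using that by (simp add: K_def)
    show "p \<notin> C" if "p \<in> K" for p
      using that CN[of p] by (auto simp: K_def abs_le_iff)
  qed
  then obtain h where h: "homotopic_with (\<lambda>_. True) M M id h"
    and le: "\<forall>q. h q = q \<or> \<Phi> (h q) < \<Phi> q" and lt: "\<forall>q\<in>K. \<Phi> (h q) < \<Phi> q"
    by blast
  have "\<exists>d>0. \<forall>q\<in>K. d \<le> \<Phi> q - \<Phi> (h q)"
  proof (cases "K = {}")
    case True
    then show ?thesis
      by (intro exI[of _ 1]) simp
  next
    case False
    have "continuous_map M euclideanreal (\<lambda>q. \<Phi> q - \<Phi> (h q))"
      using \<Phi> continuous_map_compose[OF homotopic_id_continuous[OF h] \<Phi>]
      by (intro continuous_map_diff) (simp_all add: o_def)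
    then have "compactin euclideanreal ((\<lambda>q. \<Phi> q - \<Phi> (h q)) ` K)"
      using K by (rule image_compactin[rotated])
    then have "compact ((\<lambda>q. \<Phi> q - \<Phi> (h q)) ` K)"
      by simp
    then obtain q0 where "q0 \<in> K" "\<forall>q\<in>K. \<Phi> q0 - \<Phi> (h q0) \<le> \<Phi> q - \<Phi> (h q)"
      using compact_attains_inf[of "(\<lambda>q. \<Phi> q - \<Phi> (h q)) ` K"] False by auto
    then show ?thesis
      using lt by (intro exI[of _ "\<Phi> q0 - \<Phi> (h q0)"]) simp
  qed
  then obtain d where d: "0 < d" "\<forall>q\<in>K. d \<le> \<Phi> q - \<Phi> (h q)"
    by blast
  \<comment> \<open>Passing from level \<open>c + \<epsilon>\<close> to
    \<open>c - \<epsilon>\<close> costs a drop of \<open>2 * \<epsilon>\<close>, which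
    \<open>d\<close> must cover; \<open>\<epsilon> \<le> e\<close> ensures that points outside both
    \<open>K\<close> and \<open>N\<close> already lie below \<open>c - \<epsilon>\<close>.\<close>
  define \<epsilon> where "\<epsilon> = min e (d / 2)"
  have \<epsilon>: "0 < \<epsilon>" "\<epsilon> \<le> e" "\<epsilon> \<le> d / 2"
    using e d by (auto simp: \<epsilon>_def)
  have "homotopic_cover M Y f g {q \<in> topspace M. \<Phi> q \<le> c + \<epsilon>} (n + m)"
    if n: "homotopic_cover M Y f g {q \<in> topspace M. \<Phi> q \<le> c - \<epsilon>} n" for n
  proof -
    have "homotopic_cover M Y f g ({q \<in> topspace M. \<Phi> q \<le> c + \<epsilon>} - N) n"
    proof (rule homotopic_cover_pullback[OF h f g n])
      have "\<Phi> (h q) \<le> c - \<epsilon>" if q: "q \<in> topspace M" "\<Phi> q \<le> c + \<epsilon>" "q \<notin> N" for q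
      proof (cases "q \<in> K")
        case True
        then have "d \<le> \<Phi> q - \<Phi> (h q)"
          using d by blast
        then show ?thesis
          using q \<epsilon> by linarith
      next
        case False
        then have "\<Phi> q < c - e"
          using q \<epsilon> by (auto simp: K_def)
        moreover have "\<Phi> (h q) \<le> \<Phi> q"
          using le[THEN spec, of q] by auto
        ultimately show ?thesis
          using \<epsilon> by linarith
      qed
      moreover have "h \<in> topspace M \<rightarrow> topspace M"
        using homotopic_id_continuous[OF h] by (simp add: continuous_map_def)
      ultimately show "h ` ({q \<in> topspace M. \<Phi> q \<le> c + \<epsilon>} - N) \<subseteq> {q \<in> topspace M. \<Phi> q \<le> c - \<epsilon>}"
        by auto
    qed auto
    then have "homotopic_cover M Y f g (({q \<in> topspace M. \<Phi> q \<le> c + \<epsilon>} - N) \<union> N) (n + m)"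
      using N(2) by (rule homotopic_cover_Un)
    then show ?thesis
      by (rule homotopic_cover_subset) blast
  qed
  with \<epsilon>(1) show ?thesis
    by blast
qed

text \<open>Induction along the real line: the levels up to which the count holds form a downward
  closed set, and the step at its supremum would carry the count beyond it. Regular and critical
  levels are thus treated alike, with steps of varying size.\<close>

lemma sublevel_cover:
  fixes \<Phi> :: "'m \<Rightarrow> real" and c :: "'i \<Rightarrow> real"
  assumes M: "compact_space M" and \<Phi>: "continuous_map M euclideanreal \<Phi>"
    and f: "continuous_map M Y f"
    and I: "finite I"
    and crit: "\<And>i. i \<in> I \<Longrightarrow> \<exists>\<epsilon>>0. \<forall>n. homotopic_cover M Y f g {q \<in> topspace M. \<Phi> q \<le> c i - \<epsilon>} n \<longrightarrow>
           homotopic_cover M Y f g {q \<in> topspace M. \<Phi> q \<le> c i + \<epsilon>} (n + m i)"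
    and noncrit: "\<And>t. t \<notin> c ` I \<Longrightarrow> \<exists>\<epsilon>>0. \<forall>n. homotopic_cover M Y f g {q \<in> topspace M. \<Phi> q \<le> t - \<epsilon>} n \<longrightarrow>
           homotopic_cover M Y f g {q \<in> topspace M. \<Phi> q \<le> t + \<epsilon>} n"
  shows "homotopic_cover M Y f g (topspace M) (sum m I)"
proof -
  define S where "S t = homotopic_cover M Y f g {q \<in> topspace M. \<Phi> q \<le> t} (\<Sum>i\<in>{i\<in>I. c i \<le> t}. m i)" for t
  define X where "X = {t. \<forall>s\<le>t. S s}"
  have "compactin euclideanreal (\<Phi> ` topspace M)"
    by (rule image_compactin[OF _ \<Phi>]) (use M in \<open>simp add: compact_space_def\<close>)
  then have "bounded (\<Phi> ` topspace M)"
    by (simp add: compact_imp_bounded)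
  then obtain b where b: "\<And>q. q \<in> topspace M \<Longrightarrow> \<bar>\<Phi> q\<bar> \<le> b"
    by (auto simp: bounded_iff)
  have "S s" if "s \<le> - b - 1" for s
  proof -
    have "{q \<in> topspace M. \<Phi> q \<le> s} = {}"
      using b that by fastforce
    then show ?thesis
      unfolding S_def using homotopic_cover_empty[OF f] by metis
  qed
  then have X0: "- b - 1 \<in> X"
    by (simp add: X_def)
  \<comment> \<open>Only \<open>S\<close> at the single level \<open>t - \<epsilon>\<close> is
    assumed, strictly below \<open>t\<close>; this is what is available at a supremum not yet known
    to belong to \<open>X\<close>.\<close>
  have step: "\<exists>\<epsilon>>0. S (t - \<epsilon>) \<longrightarrow> (\<forall>s. t \<le> s \<and> s \<le> t + \<epsilon> \<longrightarrow> S s)" for t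
  proof (cases "t \<in> c ` I")
    case True
    then obtain i where i: "i \<in> I" "t = c i"
      by blast
    obtain \<epsilon> where \<epsilon>: "0 < \<epsilon>" "\<forall>n. homotopic_cover M Y f g {q \<in> topspace M. \<Phi> q \<le> t - \<epsilon>} n \<longrightarrow>
           homotopic_cover M Y f g {q \<in> topspace M. \<Phi> q \<le> t + \<epsilon>} (n + m i)"
      using crit[OF i(1)] i(2) by blast
    have "S s" if "S (t - \<epsilon>)" "t \<le> s" "s \<le> t + \<epsilon>" for s
    proof -
      have "homotopic_cover M Y f g {q \<in> topspace M. \<Phi> q \<le> t + \<epsilon>} ((\<Sum>i\<in>{i\<in>I. c i \<le> t - \<epsilon>}. m i) + m i)"
        using that(1) \<epsilon>(2) by (simp add: S_def)
      then have "homotopic_cover M Y f g {q \<in> topspace M. \<Phi> q \<le> s} ((\<Sum>i\<in>{i\<in>I. c i \<le> t - \<epsilon>}. m i) + m i)"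
        by (rule homotopic_cover_subset) (use that in auto)
      \<comment> \<open>The index \<open>i\<close> is new, because \<open>c i = t\<close> exceeds
        \<open>t - \<epsilon>\<close>; its weight is counted exactly once.\<close>
      moreover have "(\<Sum>i\<in>{i\<in>I. c i \<le> t - \<epsilon>}. m i) + m i = sum m (insert i {i\<in>I. c i \<le> t - \<epsilon>})"
        using I i \<epsilon>(1) by simp
      moreover have "\<dots> \<le> (\<Sum>i\<in>{i\<in>I. c i \<le> s}. m i)"
        using I i \<epsilon>(1) that by (intro sum_mono2) auto
      ultimately show ?thesis
        unfolding S_def using homotopic_cover_mono[OF f] by simp
    qed
    with \<epsilon>(1) show ?thesis
      by blast
  next
    case False
    obtain \<epsilon> where \<epsilon>: "0 < \<epsilon>" "\<forall>n. homotopic_cover M Y f g {q \<in> topspace M. \<Phi> q \<le> t - \<epsilon>} n \<longrightarrow>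
           homotopic_cover M Y f g {q \<in> topspace M. \<Phi> q \<le> t + \<epsilon>} n"
      using noncrit[OF False] by blast
    have "S s" if "S (t - \<epsilon>)" "t \<le> s" "s \<le> t + \<epsilon>" for s
    proof -
      have "homotopic_cover M Y f g {q \<in> topspace M. \<Phi> q \<le> t + \<epsilon>} (\<Sum>i\<in>{i\<in>I. c i \<le> t - \<epsilon>}. m i)"
        using that(1) \<epsilon>(2) by (simp add: S_def)
      then have "homotopic_cover M Y f g {q \<in> topspace M. \<Phi> q \<le> s} (\<Sum>i\<in>{i\<in>I. c i \<le> t - \<epsilon>}. m i)"
        by (rule homotopic_cover_subset) (use that in auto)
      moreover have "(\<Sum>i\<in>{i\<in>I. c i \<le> t - \<epsilon>}. m i) \<le> (\<Sum>i\<in>{i\<in>I. c i \<le> s}. m i)"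
        using I \<epsilon>(1) that by (intro sum_mono2) auto
      ultimately show ?thesis
        unfolding S_def by (rule homotopic_cover_mono[OF f])
    qed
    with \<epsilon>(1) show ?thesis
      by blast
  qed
  have "\<not> bdd_above X"
  proof
    assume bdd: "bdd_above X"
    define t where "t = Sup X"
    obtain \<epsilon> where \<epsilon>: "0 < \<epsilon>" "S (t - \<epsilon>) \<longrightarrow> (\<forall>s. t \<le> s \<and> s \<le> t + \<epsilon> \<longrightarrow> S s)"
      using step by blast
    have below: "S s" if "s < t" for s
    proof -
      have "X \<noteq> {}"
        using X0 by blast
      then have "\<exists>x\<in>X. s < x"
        using that unfolding t_def by (rule less_cSupD)
      then show ?thesis
        by (auto simp: X_def)
    qed
    have "S s" if "s \<le> t + \<epsilon>" for s
      using below[of s] below[of "t - \<epsilon>"] \<epsilon> that by (cases "s < t") auto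
    then have "t + \<epsilon> \<in> X"
      by (simp add: X_def)
    then have "t + \<epsilon> \<le> t"
      unfolding t_def using bdd by (rule cSup_upper)
    with \<epsilon>(1) show False
      by simp
  qed
  then obtain t where "t \<in> X" "b \<le> t"
    unfolding bdd_above_def by (meson linear)
  then have "S b"
    by (simp add: X_def)
  then have "homotopic_cover M Y f g {q \<in> topspace M. \<Phi> q \<le> b} (sum m I)"
    unfolding S_def by (rule homotopic_cover_mono[OF f]) (use I in \<open>auto intro: sum_mono2\<close>)
  then show ?thesis
    by (rule homotopic_cover_subset) (use b in force)
qed

section \<open>From a cover of M to the inequality of distances\<close>

theorem theorem4p5:
  fixes M :: "'m topology"
    and A :: "('m set \<times> ('m \<Rightarrow> 'e::{real_inner,heine_borel})) set"
    and \<Phi> :: "'m \<Rightarrow> real"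
    and p :: nat and c :: "nat \<Rightarrow> real" and \<Sigma> :: "nat \<Rightarrow> 'm set"
    and Y :: "'y topology" and f g :: "'m \<Rightarrow> 'y"
  assumes "smooth_manifold M A" and "compact_space M"
    and "path_connected_space M" and "topspace M \<noteq> {}"
    and "morse_bott M A \<Phi>"
    and "strict_mono_on {1..p} c" and "c ` {1..p} = critical_values M A \<Phi>"
    and "\<And>i. i \<in> {1..p} \<Longrightarrow> \<Sigma> i = {x \<in> topspace M. \<Phi> x = c i} \<inter> critical_points M A \<Phi>"
    and "path_connected_space Y"
    and "continuous_map M Y f" and "continuous_map M Y g"
  shows "homotopic_distance M Y f g + 1 \<le> (\<Sum>i = 1..p. subspace_distance M (\<Sigma> i) Y f g + 1)"
proof (cases "\<exists>i\<in>{1..p}. subspace_distance M (\<Sigma> i) Y f g = \<infinity>")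
  case True
  then obtain i where i: "i \<in> {1..p}" "subspace_distance M (\<Sigma> i) Y f g + 1 = \<infinity>"
    by auto
  have "subspace_distance M (\<Sigma> i) Y f g + 1 \<le> (\<Sum>i = 1..p. subspace_distance M (\<Sigma> i) Y f g + 1)"
    using i(1) by (intro member_le_sum) auto
  then show ?thesis
    using i(2) by simp
next
  case False
  then have "\<forall>i\<in>{1..p}. \<exists>n. subspace_distance M (\<Sigma> i) Y f g = enat n"
    by auto
  then obtain n where n: "\<And>i. i \<in> {1..p} \<Longrightarrow> subspace_distance M (\<Sigma> i) Y f g = enat (n i)"
    by metis
  note M = assms(1) and cpt = assms(2) and mb = assms(5) and f = assms(10) and g = assms(11)
  define C where "C = critical_points M A \<Phi>"
  have smooth: "smooth_function A \<Phi>"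
    using mb by (simp add: morse_bott_def)
  have \<Phi>: "continuous_map M euclideanreal \<Phi>"
    by (rule smooth_function_continuous_map[OF M smooth])
  have clC: "closedin M C"
    unfolding C_def by (rule closedin_critical_points[OF M smooth])
  have \<Phi>C: "\<Phi> ` C = c ` {1..p}"
    using assms(7) by (simp add: critical_values_def C_def)
  have \<Sigma>: "\<Sigma> i = {q \<in> C. \<Phi> q = c i}" if "i \<in> {1..p}" for i
    using assms(8)[OF that] by (auto simp: C_def critical_points_def)
  have cross: "\<exists>\<epsilon>>0. \<forall>n. homotopic_cover M Y f g {q \<in> topspace M. \<Phi> q \<le> t - \<epsilon>} n \<longrightarrow>
           homotopic_cover M Y f g {q \<in> topspace M. \<Phi> q \<le> t + \<epsilon>} (n + m)"
    if N: "openin M N" "homotopic_cover M Y f g N m" "\<And>q. q \<in> C \<Longrightarrow> \<Phi> q = t \<Longrightarrow> q \<in> N" for t N m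
  proof -
    \<comment> \<open>Critical values are finite in number, so \<open>d\<close> separates
      \<open>t\<close> from all others, whether or not \<open>t\<close> is critical. In the strip of
      half-width \<open>d / 2\<close> all critical points therefore lie on the level
      \<open>t\<close> itself.\<close>
    obtain d where d: "0 < d" "\<And>x. x \<in> c ` {1..p} \<Longrightarrow> x \<noteq> t \<Longrightarrow> d \<le> dist t x"
      using finite_set_avoid[of "c ` {1..p}" t] by auto
    show ?thesis
    proof (rule cross_level[OF cpt \<Phi> f g _ _ N(1,2), of C "d / 2"])
      show "q \<in> N" if "q \<in> C" "\<bar>\<Phi> q - t\<bar> \<le> d / 2" for q
      proof -
        have "\<Phi> q \<in> c ` {1..p}"
          using \<Phi>C that by blast
        then have "\<Phi> q \<noteq> t \<Longrightarrow> d \<le> \<bar>t - \<Phi> q\<bar>"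
          using d(2) by (simp add: dist_real_def)
        then have "\<Phi> q = t"
          using d(1) that(2) by argo
        then show ?thesis
          using N(3) that by blast
      qed
    qed (use d noncritical_push_exists[OF M smooth] in \<open>auto simp: C_def\<close>)
  qed
  have "homotopic_cover M Y f g (topspace M) (\<Sum>i = 1..p. Suc (n i))"
  proof (rule sublevel_cover[OF cpt \<Phi> f, where c = c])
    fix i assume i: "i \<in> {1..p}"
    have "\<Sigma> i = C \<inter> {q \<in> topspace M. \<Phi> q \<in> {c i}}"
      using closedin_subset[OF clC] by (auto simp: \<Sigma>[OF i])
    moreover have "closedin M {q \<in> topspace M. \<Phi> q \<in> {c i}}"
      by (rule closedin_continuous_map_preimage[OF \<Phi>]) simp
    ultimately have cl: "closedin M (\<Sigma> i)"
      using clC by (simp only: closedin_Int)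
    then have "compactin M (\<Sigma> i)"
      using cpt by (simp add: closedin_compact_space)
    then have "\<exists>h N. homotopic_with (\<lambda>_. True) M M id h \<and> openin M N \<and> \<Sigma> i \<subseteq> N \<and> h ` N \<subseteq> \<Sigma> i"
    proof (rule compactin_push_into)
      fix q assume "q \<in> \<Sigma> i"
      then have "q \<in> critical_points M A \<Phi>" "\<Sigma> i = {x \<in> critical_points M A \<Phi>. \<Phi> x = \<Phi> q}"
        by (auto simp: \<Sigma>[OF i] C_def)
      then show "\<exists>h V. homotopic_with (\<lambda>_. True) M M id h \<and> openin M V \<and> q \<in> V \<and>
          (\<forall>x\<in>\<Sigma> i. h x = x) \<and> h ` V \<subseteq> \<Sigma> i"
        using critical_push_exists[OF M mb] by simp
    qed
    then obtain h N where hN: "homotopic_with (\<lambda>_. True) M M id h" "openin M N" "\<Sigma> i \<subseteq> N" "h ` N \<subseteq> \<Sigma> i"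
      by blast
    have "homotopic_cover M Y f g N (Suc (n i))"
      by (rule homotopic_cover_neighbourhood[OF hN(1) f g hN(2,4) closedin_subset[OF cl] n[OF i]])
    then show "\<exists>\<epsilon>>0. \<forall>k. homotopic_cover M Y f g {q \<in> topspace M. \<Phi> q \<le> c i - \<epsilon>} k \<longrightarrow>
           homotopic_cover M Y f g {q \<in> topspace M. \<Phi> q \<le> c i + \<epsilon>} (k + Suc (n i))"
      using hN(3) by (intro cross[OF hN(2)]) (auto simp: \<Sigma>[OF i])
  next
    fix t assume "t \<notin> c ` {1..p}"
    then show "\<exists>\<epsilon>>0. \<forall>k. homotopic_cover M Y f g {q \<in> topspace M. \<Phi> q \<le> t - \<epsilon>} k \<longrightarrow>
           homotopic_cover M Y f g {q \<in> topspace M. \<Phi> q \<le> t + \<epsilon>} k"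
      using cross[OF openin_empty homotopic_cover_empty[OF f, of g 0], of t] \<Phi>C by auto
  qed simp
  \<comment> \<open>Nonemptiness of M rules out the empty sum, as zero sets cover no point. The
    total can then be written as \<open>Suc k\<close>, matching the shift between the number of sets
    and the distance.\<close>
  moreover have "(\<Sum>i = 1..p. Suc (n i)) \<noteq> 0"
  proof
    assume "(\<Sum>i = 1..p. Suc (n i)) = 0"
    with calculation have "homotopic_cover M Y f g (topspace M) 0"
      by simp
    then show False
      using assms(4) by (simp add: homotopic_cover_def)
  qed
  ultimately obtain k where k: "(\<Sum>i = 1..p. Suc (n i)) = Suc k" "homotopic_cover M Y f g (topspace M) (Suc k)"
    using not0_implies_Suc by metis
  have "homotopic_distance M Y f g + 1 \<le> enat k + 1"
    using homotopic_distance_le[OF k(2)] by (rule add_right_mono)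
  also have "\<dots> = enat (Suc k)"
    by (simp add: one_enat_def)
  also have "\<dots> = (\<Sum>i = 1..p. enat (Suc (n i)))"
    by (simp only: k(1)[symmetric] of_nat_eq_enat[symmetric] of_nat_sum)
  also have "\<dots> = (\<Sum>i = 1..p. subspace_distance M (\<Sigma> i) Y f g + 1)"
    by (intro sum.cong refl) (simp add: n one_enat_def)
  finally show ?thesis .
qed

end
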